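(* Let $1\le p\neq q<\infty$. Every normalized unconditional basis of the space $(\bigoplus_{n=1}^\infty\ell_p)_{\ell_q}$ has a subsequence equivalent to the unit vector basis of $\ell_p$ and another subsequence equivalent to the unit vector basis of $\ell_q$. Similarly, for $1\le p<\infty$, every normalized unconditional basis of $(\bigoplus_{n=1}^\infty\ell_p)_{c_0}$ has a subsequence equivalent to the unit vector basis of $\ell_p$ and another subsequence equivalent to the unit vector basis of $c_0$; and for $1\le q<\infty$, every normalized unconditional basis of $(\bigoplus_{n=1}^\infty c_0)_{\ell_q}$ has a subsequence equivalent to the unit vector basis of $c_0$ and another subsequence equivalent to the unit vector basis of $\ell_q$. Consequently, none of the spaces $(\bigoplus_{n=1}^\infty\ell_p)_{\ell_q}$ ($1\le p\neq q<\infty$), $(\bigoplus_{n=1}^\infty\ell_p)_{c_0}$ ($1\le p<\infty$), $(\bigoplus_{n=1}^\infty c_0)_{\ell_q}$ ($1\le q<\infty$) has a greedy basis.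
   Context: For a sequence of Banach spaces $X_n$, $(\bigoplus_{n=1}^\infty X_n)_{\ell_q}$ is the space of sequences $(x_n)$, $x_n\in X_n$, with $\|(x_n)\|=(\sum_n\|x_n\|^q)^{1/q}<\infty$, and $(\bigoplus_{n=1}^\infty X_n)_{c_0}$ is the space of sequences with $\|x_n\|\to0$ under the sup norm. Equivalently these are spaces of real matrices $a=(a(i,j))$ with norm $(\sum_j(\sum_i|a(i,j)|^p)^{q/p})^{1/q}$, with $\ell_\infty$-norms (and closure of finitely supported matrices, i.e. $c_0$) replacing $\ell_p$ or $\ell_q$ when the index is $\infty$. A Schauder basis $\{x_i\}$ of a Banach space $X$ is unconditional if there is $C<\infty$ with $\|\sum \varepsilon_i a_i x_i\|\le C\|\sum a_ix_i\|$ for all finitely supported scalars $(a_i)$ and signs $\varepsilon_i=\pm1$. It is democratic if there is $C<\infty$ with $\|\sum_{i\in A}x_i\|\le C\|\sum_{i\in B}x_i\|$ for all finite $A,B\subset\mathbb{N}$ with $|A|=|B|$. It is greedy if there is $C<\infty$ such that for every $x=\sum a_ix_i\in X$, every $n\in\mathbb{N}$ and every $A\subset\mathbb{N}$ with $|A|=n$ and $\min_{i\in A}|a_i|\ge\sup_{i\notin A}|a_i|$, one has $\|x-\sum_{i\in A}a_ix_i\|\le C\inf\{\|x-\sum_{i\in B}b_ix_i\|: |B|=n,\ b_i\in\mathbb{R}\}$. Two sequences $\{u_i\},\{v_i\}$ are equivalent if there are constants $0<c\le C$ with $c\|\sum a_iv_i\|\le\|\sum a_iu_i\|\le C\|\sum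 a_iv_i\|$ for all finitely supported scalars. *)

theory Defs
  imports "HOL-Analysis.Analysis"
begin

text \<open>Exponents: Fin p stands for the sequence space l_p (p >= 1),
  C0 stands for c_0 (the "index infinity" case, closure of finitely supported sequences).\<close>
datatype exponent = Fin real | C0

fun in_seq :: "exponent \<Rightarrow> (nat \<Rightarrow> real) \<Rightarrow> bool" where
  "in_seq (Fin p) a = summable (\<lambda>i. \<bar>a i\<bar> powr p)"
| "in_seq C0 a = (a \<longlonglongrightarrow> 0)"

fun seqnorm :: "exponent \<Rightarrow> (nat \<Rightarrow> real) \<Rightarrow> real" where
  "seqnorm (Fin p) a = (\<Sum>i. \<bar>a i\<bar> powr p) powr (1 / p)"
| "seqnorm C0 a = (SUP i. \<bar>a i\<bar>)"

text \<open>Matrices a(i,j): the inner index i carries the e-norm (the spaces X_n),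
  the outer index j carries the f-norm.  mixed_space e f = (\<Oplus>_n X)_{f} with X = l_e.\<close>
definition mixed_space :: "exponent \<Rightarrow> exponent \<Rightarrow> (nat \<Rightarrow> nat \<Rightarrow> real) set" where
  "mixed_space e f = {a. (\<forall>j. in_seq e (\<lambda>i. a i j)) \<and> in_seq f (\<lambda>j. seqnorm e (\<lambda>i. a i j))}"

definition mnorm :: "exponent \<Rightarrow> exponent \<Rightarrow> (nat \<Rightarrow> nat \<Rightarrow> real) \<Rightarrow> real" where
  "mnorm e f a = seqnorm f (\<lambda>j. seqnorm e (\<lambda>i. a i j))"

definition lcomb :: "nat set \<Rightarrow> (nat \<Rightarrow> real) \<Rightarrow> (nat \<Rightarrow> 'v \<Rightarrow> 'w \<Rightarrow> real) \<Rightarrow> 'v \<Rightarrow> 'w \<Rightarrow> real" where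
  "lcomb A c x = (\<lambda>k l. \<Sum>i\<in>A. c i * x i k l)"

definition expands :: "((nat \<Rightarrow> nat \<Rightarrow> real) \<Rightarrow> real) \<Rightarrow> (nat \<Rightarrow> nat \<Rightarrow> nat \<Rightarrow> real)
    \<Rightarrow> (nat \<Rightarrow> nat \<Rightarrow> real) \<Rightarrow> (nat \<Rightarrow> real) \<Rightarrow> bool" where
  "expands N x y c \<longleftrightarrow> (\<lambda>n. N (y - lcomb {..<n} c x)) \<longlonglongrightarrow> 0"

definition schauder_basis :: "(nat \<Rightarrow> nat \<Rightarrow> real) set \<Rightarrow> ((nat \<Rightarrow> nat \<Rightarrow> real) \<Rightarrow> real)
    \<Rightarrow> (nat \<Rightarrow> nat \<Rightarrow> nat \<Rightarrow> real) \<Rightarrow> bool" where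
  "schauder_basis X N x \<longleftrightarrow> (\<forall>i. x i \<in> X) \<and> (\<forall>y\<in>X. \<exists>!c. expands N x y c)"

definition normalized :: "((nat \<Rightarrow> nat \<Rightarrow> real) \<Rightarrow> real) \<Rightarrow> (nat \<Rightarrow> nat \<Rightarrow> nat \<Rightarrow> real) \<Rightarrow> bool" where
  "normalized N x \<longleftrightarrow> (\<forall>i. N (x i) = 1)"

definition unconditional :: "((nat \<Rightarrow> nat \<Rightarrow> real) \<Rightarrow> real) \<Rightarrow> (nat \<Rightarrow> nat \<Rightarrow> nat \<Rightarrow> real) \<Rightarrow> bool" where
  "unconditional N x \<longleftrightarrow> (\<exists>C. \<forall>n a (\<epsilon>::nat \<Rightarrow> real). (\<forall>i. \<epsilon> i = 1 \<or> \<epsilon> i = -1) \<longrightarrow>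
      N (lcomb {..<n} (\<lambda>i. \<epsilon> i * a i) x) \<le> C * N (lcomb {..<n} a x))"

text \<open>Norm of \<Sum>_{i<n} a_i e_i for the unit vector basis of l_p / c_0.\<close>
definition unit_norm :: "exponent \<Rightarrow> nat \<Rightarrow> (nat \<Rightarrow> real) \<Rightarrow> real" where
  "unit_norm e n a = seqnorm e (\<lambda>i. if i < n then a i else 0)"

definition equiv_unit_basis :: "((nat \<Rightarrow> nat \<Rightarrow> real) \<Rightarrow> real) \<Rightarrow> (nat \<Rightarrow> nat \<Rightarrow> nat \<Rightarrow> real)
    \<Rightarrow> exponent \<Rightarrow> bool" where
  "equiv_unit_basis N u e \<longleftrightarrow> (\<exists>c C. 0 < c \<and> c \<le> C \<and> (\<forall>n a.
      c * unit_norm e n a \<le> N (lcomb {..<n} a u) \<and> N (lcomb {..<n} a u) \<le> C * unit_norm e n a))"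

definition subseq_equiv_unit_basis :: "((nat \<Rightarrow> nat \<Rightarrow> real) \<Rightarrow> real) \<Rightarrow> (nat \<Rightarrow> nat \<Rightarrow> nat \<Rightarrow> real)
    \<Rightarrow> exponent \<Rightarrow> bool" where
  "subseq_equiv_unit_basis N x e \<longleftrightarrow> (\<exists>\<phi>. strict_mono \<phi> \<and> equiv_unit_basis N (x \<circ> \<phi>) e)"

definition greedy :: "(nat \<Rightarrow> nat \<Rightarrow> real) set \<Rightarrow> ((nat \<Rightarrow> nat \<Rightarrow> real) \<Rightarrow> real)
    \<Rightarrow> (nat \<Rightarrow> nat \<Rightarrow> nat \<Rightarrow> real) \<Rightarrow> bool" where
  "greedy X N x \<longleftrightarrow> (\<exists>C. \<forall>y a A B b. y \<in> X \<longrightarrow> expands N x y a \<longrightarrow>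
      finite A \<longrightarrow> finite B \<longrightarrow> card B = card A \<longrightarrow>
      (\<forall>i\<in>A. \<forall>j. j \<notin> A \<longrightarrow> \<bar>a j\<bar> \<le> \<bar>a i\<bar>) \<longrightarrow>
      N (y - lcomb A a x) \<le> C * N (y - lcomb B b x))"

definition has_greedy_basis :: "(nat \<Rightarrow> nat \<Rightarrow> real) set \<Rightarrow> ((nat \<Rightarrow> nat \<Rightarrow> real) \<Rightarrow> real) \<Rightarrow> bool" where
  "has_greedy_basis X N \<longleftrightarrow> (\<exists>x. schauder_basis X N x \<and> greedy X N x)"

end

(* Fix an unconditional basis x_k of the matrix space with coefficient functionals x_k^*.
   Discarding entries of x_k is harmless as long as the truncated vector v_k still satisfies
   |x_k^*(v_k)| >= delta: averaging over signs, the diagonal of (x_k^*(v_l) x_k) is bounded by the full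
   double sum, so (v_k) dominates (x_k), while a second diagonal argument with disjoint supports
   gives the reverse domination. Hence whenever x_k^* detects a fixed part of x_k on disjoint sets
   of columns (respectively of rows inside finitely many columns), the x_k, or blocks of them, behave
   like the outer (respectively inner) unit vector basis.

   Let P_n be the projection onto the first n columns. If x_k^*(P_n x_k) does not tend to 0 for some n,
   the rows inside the first n columns give a subsequence equivalent to the inner basis. If it tends
   to 0 for every n, then blocks of the basis escape along the columns, and differences of unit
   vectors inside one column are close to such blocks; the inner and the outer norm would then
   agree. Exchanging rows and columns gives the outer basis. A greedy basis is unconditional and
   democratic, which is incompatible with both subsequences. *)
theory Submission
  imports Defs "HOL-Complex_Analysis.Great_Picard" "HOL-Real_Asymp.Real_Asymp"
begin

section \<open>Sequence spaces\<close>

text \<open>The tracked quantity is the number x_k^*(P x_k), not the norm of P x_k: a basis vector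
  may be spread over all rows and columns, and a lower bound on this number is all that the diagonal
  arguments ask for. The x_k^* are bounded because unconditionality lets the other terms of an
  expansion be averaged away.

  The shape of the case split comes from two uses of detection. A subsequence can be selected from
  infinitely many detected x_k. A block runs over a whole interval of indices, so a comparison of
  exponents needs all x_k from some index on. In both cases failure of the first provides the
  second.

  Differences of unit vectors occur because unit vectors may have coefficients that do not tend to
  0, already in l_1. The two norms are compared only on sums of n vectors, which grow like n^(1/p)
  or stay bounded; approximation by blocks changes such a sum by at most 1. Rows are confined to
  finitely many columns since their equivalence constants grow with the number of columns.\<close>

lemma sum_eq_single_term:
  fixes F :: "nat \<Rightarrow> real"
  assumes "m < M" "\<And>n. n \<noteq> m \<Longrightarrow> F n = 0" shows "(\<Sum>n<M. F n) = F m"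
proof -
  have "(\<Sum>n<M. F n) = (\<Sum>n\<in>{m}. F n)"
    using assms by (intro sum.mono_neutral_right) auto
  then show ?thesis by simp
qed

text \<open>\<open>Fin p\<close> makes sense for every real p; the triangle inequality holds from p
  = 1 on.\<close>

fun banach_exponent :: "exponent \<Rightarrow> bool" where
  "banach_exponent (Fin p) = (1 \<le> p)"
| "banach_exponent C0 = True"

section \<open>Convexity and Minkowski's inequality\<close>

text \<open>Away from 0 this is \<open>powr_convex\<close>. If one argument is 0, it shrinks to
  \<open>s powr p \<le> s\<close> for s in [0,1], which holds because p is at least 1.\<close>

lemma powr_convex_nonneg:
  fixes x y t p :: real
  assumes "1 \<le> p" "0 \<le> x" "0 \<le> y" "0 \<le> t" "t \<le> 1"
  shows "(t * x + (1 - t) * y) powr p \<le> t * x powr p + (1 - t) * y powr p"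
proof -
  have scaled: "(s * z) powr p \<le> s * z powr p" if "0 \<le> s" "s \<le> 1" "0 \<le> z" for s z :: real
  proof -
    have "s powr p \<le> s"
    proof (cases "s = 0")
      case False
      then have "s powr p \<le> s powr 1"
        using that assms(1) by (intro powr_mono') auto
      then show ?thesis using that False by simp
    qed (use assms in auto)
    then show ?thesis
      using that by (simp add: powr_mult mult_right_mono)
  qed
  consider "x = 0" | "y = 0" | "0 < x" "0 < y" using assms by linarith
  then show ?thesis
  proof cases
    case 1
    then show ?thesis using scaled[of "1 - t" y] assms by simp
  next
    case 2
    then show ?thesis using scaled[of t x] assms by simp
  next
    case 3
    then show ?thesis
      using convex_onD[OF powr_convex[OF assms(1)], of "1 - t" x y] assms
      by (simp add: algebra_simps)
  qed
qed

text \<open>With \<open>t = \<alpha> / (\<alpha> + \<beta>)\<close>, the quotient of a + b by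
  \<alpha> + \<beta> is the convex combination of a/\<alpha> and b/\<beta>, so convexity of the p-th
  power suffices. \<open>\<alpha>\<close> and \<open>\<beta>\<close> are strictly positive stand-ins
  for the two norms, which may vanish.\<close>

lemma minkowski_scaled:
  fixes a b :: "nat \<Rightarrow> real"
  assumes p: "1 \<le> p" and pos: "0 < \<alpha>" "0 < \<beta>"
    and a: "summable (\<lambda>i. \<bar>a i\<bar> powr p)" "(\<Sum>i. \<bar>a i\<bar> powr p) \<le> \<alpha> powr p"
    and b: "summable (\<lambda>i. \<bar>b i\<bar> powr p)" "(\<Sum>i. \<bar>b i\<bar> powr p) \<le> \<beta> powr p"
  shows "summable (\<lambda>i. \<bar>a i + b i\<bar> powr p)"
    and "(\<Sum>i. \<bar>a i + b i\<bar> powr p) \<le> (\<alpha> + \<beta>) powr p"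
proof -
  define t where "t = \<alpha> / (\<alpha> + \<beta>)"
  have t: "0 \<le> t" "t \<le> 1" "1 - t = \<beta> / (\<alpha> + \<beta>)"
    using pos by (auto simp: t_def field_simps)
  define g where "g i = (\<alpha> + \<beta>) powr p *
    (t / \<alpha> powr p * \<bar>a i\<bar> powr p + (1 - t) / \<beta> powr p * \<bar>b i\<bar> powr p)" for i
  have le: "\<bar>a i + b i\<bar> powr p \<le> g i" for i
  proof -
    have "\<bar>a i + b i\<bar> \<le> \<bar>a i\<bar> + \<bar>b i\<bar>" by simp
    also have "\<dots> = (\<alpha> + \<beta>) * (t * (\<bar>a i\<bar> / \<alpha>) + (1 - t) * (\<bar>b i\<bar> / \<beta>))"
      using pos unfolding t(3) by (simp add: t_def distrib_left)
    finally have "\<bar>a i + b i\<bar> powr p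
        \<le> ((\<alpha> + \<beta>) * (t * (\<bar>a i\<bar> / \<alpha>) + (1 - t) * (\<bar>b i\<bar> / \<beta>))) powr p"
      using p by (intro powr_mono2) auto
    also have "\<dots> = (\<alpha> + \<beta>) powr p * (t * (\<bar>a i\<bar> / \<alpha>) + (1 - t) * (\<bar>b i\<bar> / \<beta>)) powr p"
      using pos t by (intro powr_mult)
    also have "\<dots> \<le> (\<alpha> + \<beta>) powr p *
        (t * (\<bar>a i\<bar> / \<alpha>) powr p + (1 - t) * (\<bar>b i\<bar> / \<beta>) powr p)"
      using p pos t by (intro mult_left_mono powr_convex_nonneg) auto
    also have "\<dots> = g i"
      using pos by (simp add: g_def powr_divide)
    finally show ?thesis .
  qed
  have g: "summable g"
    unfolding g_def using a b by (intro summable_mult summable_add) auto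
  show summ: "summable (\<lambda>i. \<bar>a i + b i\<bar> powr p)"
    by (rule summable_comparison_test[OF _ g]) (use le in auto)
  have "(\<Sum>i. \<bar>a i + b i\<bar> powr p) \<le> suminf g"
    using le summ g by (intro suminf_le) auto
  also have "\<dots> = (\<alpha> + \<beta>) powr p *
      (t / \<alpha> powr p * (\<Sum>i. \<bar>a i\<bar> powr p) + (1 - t) / \<beta> powr p * (\<Sum>i. \<bar>b i\<bar> powr p))"
    unfolding g_def using a(1) b(1)
    by (intro sums_unique[symmetric] sums_mult sums_add summable_sums)
  also have "\<dots> \<le> (\<alpha> + \<beta>) powr p *
      (t / \<alpha> powr p * \<alpha> powr p + (1 - t) / \<beta> powr p * \<beta> powr p)"
    using a b t pos by (intro mult_left_mono add_mono) auto
  also have "\<dots> = (\<alpha> + \<beta>) powr p" using pos by simp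
  finally show "(\<Sum>i. \<bar>a i + b i\<bar> powr p) \<le> (\<alpha> + \<beta>) powr p" .
qed

lemma seqnorm_nonneg: "in_seq e a \<Longrightarrow> 0 \<le> seqnorm e a"
proof (cases e)
  case C0
  assume "in_seq e a"
  then have "bounded (range a)" using C0 by (auto intro: convergent_imp_bounded)
  then have "bdd_above (range (\<lambda>i. \<bar>a i\<bar>))"
    by (auto simp: bounded_iff bdd_above_def)
  then have "\<bar>a 0\<bar> \<le> (SUP i. \<bar>a i\<bar>)" by (intro cSUP_upper) auto
  then show ?thesis using C0 by simp
qed simp

lemma bdd_above_null_seq: "(a :: nat \<Rightarrow> real) \<longlonglongrightarrow> 0 \<Longrightarrow> bdd_above (range (\<lambda>i. \<bar>a i\<bar>))"
  using convergent_imp_bounded[of a 0] by (auto simp: bounded_iff bdd_above_def)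

lemma abs_le_seqnorm: assumes "banach_exponent e" "in_seq e a" shows "\<bar>a i\<bar> \<le> seqnorm e a"
proof (cases e)
  case (Fin p)
  have "\<bar>a i\<bar> = (\<bar>a i\<bar> powr p) powr (1 / p)"
    using assms Fin by (simp add: powr_powr)
  also have "\<dots> \<le> (\<Sum>i. \<bar>a i\<bar> powr p) powr (1 / p)"
    using assms Fin sum_le_suminf[of "\<lambda>i. \<bar>a i\<bar> powr p" "{i}"]
    by (intro powr_mono2) auto
  finally show ?thesis using Fin by simp
next
  case C0
  then show ?thesis
    using bdd_above_null_seq[of a] assms by (auto intro: cSUP_upper)
qed

lemma seqnorm_powr: assumes "1 \<le> p" "summable (\<lambda>i. \<bar>a i\<bar> powr p)"
  shows "seqnorm (Fin p) a powr p = (\<Sum>i. \<bar>a i\<bar> powr p)"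
  using assms by (simp add: powr_powr suminf_nonneg)

lemma in_seq_add_seqnorm_add:
  assumes "banach_exponent e" "in_seq e a" "in_seq e b"
  shows "in_seq e (\<lambda>i. a i + b i) \<and> seqnorm e (\<lambda>i. a i + b i) \<le> seqnorm e a + seqnorm e b"
proof (cases e)
  case (Fin p)
  have p: "1 \<le> p" and a: "summable (\<lambda>i. \<bar>a i\<bar> powr p)" and b: "summable (\<lambda>i. \<bar>b i\<bar> powr p)"
    using assms Fin by auto
  let ?A = "seqnorm (Fin p) a" and ?B = "seqnorm (Fin p) b"
  have nn: "0 \<le> ?A" "0 \<le> ?B" by auto
  \<comment> \<open>A norm may be 0, so each is enlarged by \<open>\<epsilon>\<close> before
    \<open>minkowski_scaled\<close> is applied.\<close>
  have approx: "(\<Sum>i. \<bar>a i\<bar> powr p) \<le> (?A + \<epsilon>) powr p" "(\<Sum>i. \<bar>b i\<bar> powr p) \<le> (?B + \<epsilon>) powr p"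
    if "\<epsilon> > 0" for \<epsilon>
  proof -
    have "?A powr p \<le> (?A + \<epsilon>) powr p" "?B powr p \<le> (?B + \<epsilon>) powr p"
      using that p nn by (auto intro!: powr_mono2)
    then show "(\<Sum>i. \<bar>a i\<bar> powr p) \<le> (?A + \<epsilon>) powr p" "(\<Sum>i. \<bar>b i\<bar> powr p) \<le> (?B + \<epsilon>) powr p"
      using seqnorm_powr[OF p a] seqnorm_powr[OF p b] by auto
  qed
  have pos: "?A + \<epsilon> > 0" "?B + \<epsilon> > 0" if "\<epsilon> > 0" for \<epsilon>
    using that nn by (auto intro: add_nonneg_pos simp del: seqnorm.simps)
  have summ: "summable (\<lambda>i. \<bar>a i + b i\<bar> powr p)"
    using minkowski_scaled(1)[OF p pos(1)[of 1] pos(2)[of 1] a approx(1) b approx(2)] by simp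
  have "seqnorm (Fin p) (\<lambda>i. a i + b i) \<le> ?A + ?B"
  proof (rule field_le_epsilon)
    fix \<epsilon> :: real assume "\<epsilon> > 0"
    then have h: "\<epsilon> / 2 > 0" by simp
    have "(\<Sum>i. \<bar>a i + b i\<bar> powr p) \<le> ((?A + \<epsilon>/2) + (?B + \<epsilon>/2)) powr p"
      by (rule minkowski_scaled(2)[OF p pos(1)[OF h] pos(2)[OF h] a approx(1)[OF h] b approx(2)[OF h]])
    then have "seqnorm (Fin p) (\<lambda>i. a i + b i) \<le> (((?A + \<epsilon>/2) + (?B + \<epsilon>/2)) powr p) powr (1/p)"
      unfolding seqnorm.simps using p summ by (intro powr_mono2 suminf_nonneg) auto
    also have "\<dots> = (?A + \<epsilon>/2) + (?B + \<epsilon>/2)"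
      using p pos(1)[OF h] pos(2)[OF h] by (simp add: powr_powr del: seqnorm.simps)
    finally show "seqnorm (Fin p) (\<lambda>i. a i + b i) \<le> ?A + ?B + \<epsilon>" by simp
  qed
  then show ?thesis using Fin summ by simp
next
  case C0
  have lim: "a \<longlonglongrightarrow> 0" "b \<longlonglongrightarrow> 0" using assms C0 by auto
  have "seqnorm e (\<lambda>i. a i + b i) \<le> seqnorm e a + seqnorm e b"
    unfolding C0 seqnorm.simps
  proof (rule cSUP_least)
    fix i
    have "\<bar>a i\<bar> \<le> (SUP i. \<bar>a i\<bar>)" "\<bar>b i\<bar> \<le> (SUP i. \<bar>b i\<bar>)"
      using abs_le_seqnorm[of C0 a i] abs_le_seqnorm[of C0 b i] lim by auto
    then show "\<bar>a i + b i\<bar> \<le> (SUP i. \<bar>a i\<bar>) + (SUP i. \<bar>b i\<bar>)" by linarith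
  qed auto
  then show ?thesis using C0 tendsto_add[OF lim] by simp
qed

lemmas in_seq_add = in_seq_add_seqnorm_add[THEN conjunct1]
lemmas seqnorm_add = in_seq_add_seqnorm_add[THEN conjunct2]

lemma in_seq_mono_seqnorm_mono:
  assumes "banach_exponent e" "in_seq e a" "\<And>i. \<bar>b i\<bar> \<le> \<bar>a i\<bar>"
  shows "in_seq e b \<and> seqnorm e b \<le> seqnorm e a"
proof (cases e)
  case (Fin p)
  have p: "1 \<le> p" and a: "summable (\<lambda>i. \<bar>a i\<bar> powr p)"
    using assms Fin by auto
  have le: "\<bar>b i\<bar> powr p \<le> \<bar>a i\<bar> powr p" for i
    using assms p by (intro powr_mono2) auto
  have b: "summable (\<lambda>i. \<bar>b i\<bar> powr p)"
    by (rule summable_comparison_test[OF _ a]) (use le in auto)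
  then show ?thesis
    using Fin p suminf_le[OF le b a] suminf_nonneg[OF b] by (auto intro!: powr_mono2)
next
  case C0
  have a: "a \<longlonglongrightarrow> 0" using assms C0 by auto
  then have "b \<longlonglongrightarrow> 0"
    using Lim_null_comparison[of b "\<lambda>i. \<bar>a i\<bar>" sequentially] assms(3)
    by (auto simp: tendsto_rabs_zero_iff)
  moreover have "(SUP i. \<bar>b i\<bar>) \<le> (SUP i. \<bar>a i\<bar>)"
    using bdd_above_null_seq[OF a] assms(3) by (intro cSUP_mono) auto
  ultimately show ?thesis using C0 by simp
qed

lemmas in_seq_mono = in_seq_mono_seqnorm_mono[THEN conjunct1]
lemmas seqnorm_mono = in_seq_mono_seqnorm_mono[THEN conjunct2]

lemma in_seq_finite_support:
  assumes "banach_exponent e" "finite {i. a i \<noteq> 0}" shows "in_seq e a"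
proof (cases e)
  case (Fin p)
  have "summable (\<lambda>i. \<bar>a i\<bar> powr p)"
    by (rule summable_finite[OF assms(2)]) auto
  then show ?thesis using Fin by simp
next
  case C0
  obtain n where n: "\<forall>i\<in>{i. a i \<noteq> 0}. i < n"
    using finite_nat_set_iff_bounded assms(2) by blast
  have "\<forall>\<^sub>F i in sequentially. a i = 0"
    using n by (intro eventually_sequentiallyI[of n]) (auto simp: not_less[symmetric])
  then have "a \<longlonglongrightarrow> 0" by (simp add: tendsto_eventually)
  then show ?thesis using C0 by simp
qed

text \<open>At each index at most one summand is nonzero, so the p-th power, or the modulus in c_0,
  passes through the sum. Disjointly supported vectors of norm 1 are thus an isometric copy of the
  unit vector basis; the estimates for columns and for rows both rest on this.\<close>

lemma seqnorm_disjoint_sum: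
  assumes e: "banach_exponent e" and u: "\<And>m. in_seq e (u m)"
    and disj: "\<And>l m n. u m l \<noteq> 0 \<Longrightarrow> u n l \<noteq> 0 \<Longrightarrow> m = n"
  shows "seqnorm e (\<lambda>l. \<Sum>m<M. a m * u m l) = unit_norm e M (\<lambda>m. a m * seqnorm e (u m))"
proof (cases e)
  case (Fin p)
  have p: "1 \<le> p" and summ: "\<And>m. summable (\<lambda>l. \<bar>u m l\<bar> powr p)"
    using e u Fin by auto
  have pt: "\<bar>\<Sum>m<M. a m * u m l\<bar> powr p = (\<Sum>m<M. \<bar>a m\<bar> powr p * \<bar>u m l\<bar> powr p)" for l
  proof (cases "\<exists>m<M. u m l \<noteq> 0")
    case True
    then obtain m where m: "m < M" "u m l \<noteq> 0" by auto
    then have z: "u n l = 0" if "n \<noteq> m" for n using disj that by blast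
    have "(\<Sum>m<M. a m * u m l) = (\<Sum>n\<in>{m}. a n * u n l)"
      using m z by (intro sum.mono_neutral_right) auto
    moreover have "(\<Sum>m<M. \<bar>a m\<bar> powr p * \<bar>u m l\<bar> powr p) = (\<Sum>n\<in>{m}. \<bar>a n\<bar> powr p * \<bar>u n l\<bar> powr p)"
      using m z by (intro sum.mono_neutral_right) auto
    ultimately show ?thesis by (simp add: abs_mult powr_mult)
  qed auto
  have "(\<Sum>l. \<bar>\<Sum>m<M. a m * u m l\<bar> powr p) = (\<Sum>m<M. \<bar>a m\<bar> powr p * (\<Sum>l. \<bar>u m l\<bar> powr p))"
    unfolding pt using summ by (simp add: suminf_sum summable_mult suminf_mult)
  also have "\<dots> = (\<Sum>m<M. \<bar>a m * seqnorm e (u m)\<bar> powr p)"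
    using seqnorm_powr[OF p summ] seqnorm_nonneg[OF u] unfolding Fin
    by (intro sum.cong refl) (simp add: abs_mult powr_mult del: seqnorm.simps)
  also have "\<dots> = (\<Sum>i. \<bar>if i < M then a i * seqnorm e (u i) else 0\<bar> powr p)"
    by (subst suminf_finite[of "{..<M}"]) auto
  finally show ?thesis
    unfolding Fin unit_norm_def by (subst (1 2) seqnorm.simps) (rule arg_cong)
next
  case C0
  have bdd: "bdd_above (range (\<lambda>l. \<bar>u m l\<bar>))" for m
    using bdd_above_null_seq u C0 by simp
  have lim: "(\<lambda>l. \<Sum>m<M. a m * u m l) \<longlonglongrightarrow> 0"
    using u C0 by (intro tendsto_null_sum tendsto_mult_right_zero) auto
  let ?w = "\<lambda>m. if m < M then a m * seqnorm C0 (u m) else 0"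
  have "in_seq C0 ?w" using in_seq_finite_support[of C0 ?w]
    by (simp add: finite_subset[of _ "{..<M}"] subset_iff)
  then have bdw: "bdd_above (range (\<lambda>m. \<bar>?w m\<bar>))" using bdd_above_null_seq by simp
  have "(SUP l. \<bar>\<Sum>m<M. a m * u m l\<bar>) = (SUP m. \<bar>?w m\<bar>)"
  proof (rule antisym)
    show "(SUP l. \<bar>\<Sum>m<M. a m * u m l\<bar>) \<le> (SUP m. \<bar>?w m\<bar>)"
    proof (rule cSUP_least)
      fix l
      show "\<bar>\<Sum>m<M. a m * u m l\<bar> \<le> (SUP m. \<bar>?w m\<bar>)"
      proof (cases "\<exists>m<M. u m l \<noteq> 0")
        case True
        then obtain m where m: "m < M" "u m l \<noteq> 0" by auto
        then have z: "u n l = 0" if "n \<noteq> m" for n using disj that by blast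
        have "(\<Sum>m<M. a m * u m l) = (\<Sum>n\<in>{m}. a n * u n l)"
          using m z by (intro sum.mono_neutral_right) auto
        then have "\<bar>\<Sum>m<M. a m * u m l\<bar> = \<bar>a m\<bar> * \<bar>u m l\<bar>" by (simp add: abs_mult)
        also have "\<dots> \<le> \<bar>a m\<bar> * seqnorm C0 (u m)"
          using abs_le_seqnorm[of C0 "u m" l] u C0 by (intro mult_left_mono) auto
        also have "\<dots> = \<bar>?w m\<bar>"
          using m seqnorm_nonneg[OF u] C0 by (auto simp: abs_mult simp del: seqnorm.simps)
        also have "\<dots> \<le> (SUP m. \<bar>?w m\<bar>)" by (rule cSUP_upper[OF _ bdw]) auto
        finally show ?thesis .
      next
        case False
        then have "\<bar>\<Sum>m<M. a m * u m l\<bar> = 0" by simp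
        also have "0 \<le> \<bar>?w 0\<bar>" by simp
        also have "\<bar>?w 0\<bar> \<le> (SUP m. \<bar>?w m\<bar>)" by (rule cSUP_upper[OF _ bdw]) auto
        finally show ?thesis .
      qed
    qed auto
    have bds: "bdd_above (range (\<lambda>l. \<bar>\<Sum>m<M. a m * u m l\<bar>))"
      using bdd_above_null_seq[OF lim] .
    show "(SUP m. \<bar>?w m\<bar>) \<le> (SUP l. \<bar>\<Sum>m<M. a m * u m l\<bar>)" (is "_ \<le> ?S")
    proof (rule cSUP_least)
      fix m
      have S0: "0 \<le> ?S"
        using seqnorm_nonneg[of C0 "\<lambda>l. \<Sum>m<M. a m * u m l"] lim by simp
      show "\<bar>?w m\<bar> \<le> ?S"
      proof (cases "m < M \<and> a m \<noteq> 0")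
        case True
        have "seqnorm C0 (u m) \<le> ?S / \<bar>a m\<bar>"
          unfolding seqnorm.simps
        proof (rule cSUP_least)
          fix l
          have "\<bar>a m\<bar> * \<bar>u m l\<bar> \<le> ?S"
          proof (cases "u m l = 0")
            case False
            then have z: "u n l = 0" if "n \<noteq> m" for n using disj that by blast
            have "(\<Sum>m<M. a m * u m l) = (\<Sum>n\<in>{m}. a n * u n l)"
              using True z by (intro sum.mono_neutral_right) auto
            then have "\<bar>a m\<bar> * \<bar>u m l\<bar> = \<bar>\<Sum>m<M. a m * u m l\<bar>" by (simp add: abs_mult)
            also have "\<dots> \<le> ?S" by (rule cSUP_upper[OF _ bds]) auto
            finally show ?thesis .
          qed (use S0 in simp)
          then show "\<bar>u m l\<bar> \<le> ?S / \<bar>a m\<bar>" using True by (simp add: field_simps)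
        qed auto
        then show ?thesis
          using True seqnorm_nonneg[OF u, of m] C0
          by (auto simp: abs_mult field_simps simp del: seqnorm.simps)
      qed (use S0 in auto)
    qed auto
  qed
  then show ?thesis
    unfolding C0 unit_norm_def by (subst (1 2) seqnorm.simps)
qed

lemma seqnorm_single:
  assumes "banach_exponent e" shows "seqnorm e (\<lambda>i. if i = k then c else 0) = \<bar>c\<bar>"
proof (cases e)
  case (Fin p)
  have "(\<Sum>i. \<bar>if i = k then c else 0\<bar> powr p) = \<bar>c\<bar> powr p"
    by (subst suminf_finite[of "{k}"]) auto
  then show ?thesis using assms Fin by (simp add: powr_powr)
next
  case C0
  have "in_seq C0 (\<lambda>i. if i = k then c else 0)"
    by (rule in_seq_finite_support) auto
  from abs_le_seqnorm[OF _ this, of k] have "\<bar>c\<bar> \<le> seqnorm C0 (\<lambda>i. if i = k then c else 0)" by simp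
  moreover have "seqnorm C0 (\<lambda>i. if i = k then c else 0) \<le> \<bar>c\<bar>"
    unfolding seqnorm.simps by (rule cSUP_least) auto
  ultimately show ?thesis using C0 by simp
qed

lemma seqnorm_zero: "banach_exponent e \<Longrightarrow> seqnorm e (\<lambda>i. 0) = 0"
  using seqnorm_single[of e 0 0] by simp

lemma in_seq_scale_seqnorm_scale:
  assumes "banach_exponent e" "in_seq e a"
  shows "in_seq e (\<lambda>i. c * a i) \<and> seqnorm e (\<lambda>i. c * a i) = \<bar>c\<bar> * seqnorm e a"
proof
  show "in_seq e (\<lambda>i. c * a i)"
    using assms by (cases e) (auto simp: abs_mult powr_mult summable_mult tendsto_mult_right_zero)
  \<comment> \<open>One block only: with \<open>M = 1\<close>, \<open>seqnorm_disjoint_sum\<close>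
    and \<open>seqnorm_single\<close> give homogeneity for both kinds of exponent at once.\<close>
  let ?u = "\<lambda>m::nat. if m = 0 then a else (\<lambda>i. 0)"
  have "seqnorm e (\<lambda>l. \<Sum>m<1. c * ?u m l) = unit_norm e 1 (\<lambda>m. c * seqnorm e (?u m))"
    using assms by (intro seqnorm_disjoint_sum) (auto split: if_splits intro: in_seq_finite_support)
  also have "\<dots> = seqnorm e (\<lambda>i. if i = 0 then c * seqnorm e a else 0)"
    unfolding unit_norm_def by (intro arg_cong[where f="seqnorm e"] ext) auto
  also have "\<dots> = \<bar>c\<bar> * seqnorm e a"
    using assms seqnorm_nonneg[OF assms(2)] by (simp add: seqnorm_single abs_mult)
  finally show "seqnorm e (\<lambda>i. c * a i) = \<bar>c\<bar> * seqnorm e a" by simp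
qed

lemmas in_seq_scale = in_seq_scale_seqnorm_scale[THEN conjunct1]
lemmas seqnorm_scale = in_seq_scale_seqnorm_scale[THEN conjunct2]

lemma in_seq_sum_seqnorm_sum:
  assumes "banach_exponent e" "\<And>k. in_seq e (a k)"
  shows "in_seq e (\<lambda>i. \<Sum>k<n. a k i) \<and> seqnorm e (\<lambda>i. \<Sum>k<n. a k i) \<le> (\<Sum>k<n::nat. seqnorm e (a k))"
proof (induction n)
  case 0
  then show ?case using assms(1) by (simp add: seqnorm_zero in_seq_finite_support)
next
  case (Suc n)
  then show ?case
    using in_seq_add_seqnorm_add[OF assms(1) Suc[THEN conjunct1] assms(2)[of n]] by auto
qed

text \<open>This order continuity distinguishes c_0 from l_infinity at the index infinity, and it
  supplies the tail condition for columns and for rows.\<close>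

lemma seqnorm_tail_tendsto:
  assumes "banach_exponent e" "in_seq e a"
  shows "(\<lambda>n. seqnorm e (\<lambda>i. if n \<le> i then a i else 0)) \<longlonglongrightarrow> 0"
proof (cases e)
  case (Fin p)
  have p: "1 \<le> p" and a: "summable (\<lambda>i. \<bar>a i\<bar> powr p)"
    using assms Fin by auto
  have "(\<Sum>i. \<bar>if n \<le> i then a i else 0\<bar> powr p) = (\<Sum>i. \<bar>a (i + n)\<bar> powr p)" for n
  proof -
    have "summable (\<lambda>i. \<bar>if n \<le> i then a i else 0\<bar> powr p)"
      by (rule summable_comparison_test[OF _ a]) auto
    from suminf_split_initial_segment[OF this, of n] show ?thesis by simp
  qed
  moreover have "(\<lambda>n. (\<Sum>i. \<bar>a (i + n)\<bar> powr p)) \<longlonglongrightarrow> 0"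
    using suminf_exist_split2[OF a] .
  ultimately have "(\<lambda>n. (\<Sum>i. \<bar>if n \<le> i then a i else 0\<bar> powr p) powr (1/p)) \<longlonglongrightarrow> 0 powr (1/p)"
    using p by (intro tendsto_powr') (auto intro!: always_eventually suminf_nonneg simp: summable_iff_shift[of "\<lambda>i. \<bar>a i\<bar> powr p"] a)
  then show ?thesis using p Fin by simp
next
  case C0
  show ?thesis unfolding C0 seqnorm.simps
  proof (rule LIMSEQ_I)
    fix r :: real assume "0 < r"
    then obtain N where N: "\<And>n. n \<ge> N \<Longrightarrow> \<bar>a n\<bar> < r/2"
      using LIMSEQ_D[of a 0 "r/2"] assms C0 by auto
    have "norm ((SUP i. \<bar>if n \<le> i then a i else 0\<bar>) - 0) < r" if "n \<ge> N" for n
    proof -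
      have "(SUP i. \<bar>if n \<le> i then a i else 0\<bar>) \<le> r/2"
        using N that \<open>0 < r\<close> by (intro cSUP_least) (auto intro!: less_imp_le)
      moreover have "0 \<le> (SUP i. \<bar>if n \<le> i then a i else 0\<bar>)"
        using in_seq_mono[of C0 a "\<lambda>i. if n \<le> i then a i else 0"]
          seqnorm_nonneg[of C0 "\<lambda>i. if n \<le> i then a i else 0"] assms C0 by simp
      ultimately show ?thesis using \<open>0 < r\<close> by simp
    qed
    then show "\<exists>N. \<forall>n\<ge>N. norm ((SUP i. \<bar>if n \<le> i then a i else 0\<bar>) - 0) < r" by blast
  qed
qed

section \<open>Sums of unit vectors and the exponent\<close>

lemma unit_norm_in_seq: "banach_exponent e \<Longrightarrow> in_seq e (\<lambda>i. if i < n then a i else 0)"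
  by (rule in_seq_finite_support) (auto intro: finite_subset[of _ "{..<n}"])

lemma unit_norm_mono:
  assumes "banach_exponent e" "\<And>i. i < n \<Longrightarrow> \<bar>a i\<bar> \<le> \<bar>b i\<bar>"
  shows "unit_norm e n a \<le> unit_norm e n b"
  unfolding unit_norm_def using assms by (intro seqnorm_mono unit_norm_in_seq) auto

lemma unit_norm_scale: "banach_exponent e \<Longrightarrow> unit_norm e n (\<lambda>i. c * a i) = \<bar>c\<bar> * unit_norm e n a"
  unfolding unit_norm_def
  using seqnorm_scale[OF _ unit_norm_in_seq[of e n a], of c]
  by (simp add: if_distrib[of "\<lambda>z. c * z"] cong: if_cong)

lemma unit_norm_nonneg: "banach_exponent e \<Longrightarrow> 0 \<le> unit_norm e n a"
  unfolding unit_norm_def by (rule seqnorm_nonneg[OF unit_norm_in_seq])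

lemma unit_norm_ones_ge_1: "banach_exponent e \<Longrightarrow> 0 < n \<Longrightarrow> 1 \<le> unit_norm e n (\<lambda>i. 1)"
  using abs_le_seqnorm[OF _ unit_norm_in_seq[of e n "\<lambda>i. 1"], of 0] by (simp add: unit_norm_def)

lemma unit_norm_ones_Fin: "1 \<le> p \<Longrightarrow> unit_norm (Fin p) n (\<lambda>i. 1) = real n powr (1 / p)"
proof -
  have "(\<Sum>i. \<bar>if i < n then 1 else 0 :: real\<bar> powr p) = (\<Sum>i<n. 1)"
    by (subst suminf_finite[of "{..<n}"]) auto
  then show ?thesis by (simp add: unit_norm_def)
qed

lemma unit_norm_ones_C0: "0 < n \<Longrightarrow> unit_norm C0 n (\<lambda>i. 1) = 1"
proof (rule antisym)
  show "unit_norm C0 n (\<lambda>i. 1) \<le> 1"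
    unfolding unit_norm_def seqnorm.simps by (rule cSUP_least) auto
qed (use unit_norm_ones_ge_1[of C0 n] in auto)

text \<open>A sum of n unit vectors has norm n^(1/p), and n^0 = 1 in c_0, so its growth rate
  identifies the exponent. This is the only invariant by which two sequence spaces are told
  apart.\<close>

lemma exponent_eq_if_unit_norm_ones_equivalent:
  assumes e: "banach_exponent e" and f: "banach_exponent f"
    and le1: "\<And>n. 0 < n \<Longrightarrow> unit_norm e n (\<lambda>i. 1) \<le> A * unit_norm f n (\<lambda>i. 1)"
    and le2: "\<And>n. 0 < n \<Longrightarrow> unit_norm f n (\<lambda>i. 1) \<le> B * unit_norm e n (\<lambda>i. 1)"
  shows "e = f"
proof -
  define r where "r e = (case e of Fin p \<Rightarrow> 1 / p | C0 \<Rightarrow> 0)" for e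
  have un: "unit_norm e n (\<lambda>i. 1) = real n powr r e" if "banach_exponent e" "0 < n" for e n
    using that by (cases e) (auto simp: r_def unit_norm_ones_Fin unit_norm_ones_C0)
  have le: "r e \<le> r f" if "\<And>n. 0 < n \<Longrightarrow> real n powr r e \<le> K * real n powr r f" for e f K
  proof (rule ccontr)
    assume "\<not> r e \<le> r f"
    then have "filterlim (\<lambda>n. real n powr (r e - r f)) at_top sequentially"
      by real_asymp
    then have "\<forall>\<^sub>F n in sequentially. K + 1 \<le> real n powr (r e - r f)"
      by (simp add: filterlim_at_top)
    then have "\<forall>\<^sub>F n in sequentially. K + 1 \<le> real n powr (r e - r f) \<and> 0 < n"
      using eventually_gt_at_top[of "0::nat"] by eventually_elim auto
    then obtain n where n: "K + 1 \<le> real n powr (r e - r f)" "0 < n"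
      using eventually_happens'[OF sequentially_bot] by blast
    have pos: "0 < real n powr r f" using n by simp
    have "real n powr (r e - r f) * real n powr r f \<le> K * real n powr r f"
      using that[OF n(2)] by (simp flip: powr_add)
    then have "real n powr (r e - r f) \<le> K" using pos by simp
    then show False using n by simp
  qed
  have "r e = r f"
    using le[where e=e and f=f and K=A] le[where e=f and f=e and K=B] le1 le2 un[OF e] un[OF f] by force
  then show ?thesis
    using e f by (cases e; cases f) (auto simp: r_def)
qed

section \<open>Solid norms on matrices\<close>

definition restr :: "(nat \<times> nat) set \<Rightarrow> (nat \<Rightarrow> nat \<Rightarrow> real) \<Rightarrow> nat \<Rightarrow> nat \<Rightarrow> real" where
  "restr S y = (\<lambda>i j. if (i, j) \<in> S then y i j else 0)"

definition signs :: "(nat \<Rightarrow> real) \<Rightarrow> bool" where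
  "signs \<epsilon> \<longleftrightarrow> (\<forall>k. \<epsilon> k = 1 \<or> \<epsilon> k = - 1)"

lemma signs_upd: "signs \<epsilon> \<Longrightarrow> s = 1 \<or> s = - 1 \<Longrightarrow> signs (\<epsilon>(k := s))"
  by (auto simp: signs_def)

lemma signs_one: "signs (\<lambda>k. 1)"
  by (auto simp: signs_def)

text \<open>The interface through which columns and rows are treated alike. Solidity makes every
  coordinate projection \<open>restr S\<close> a contraction; \<open>abs_entry_le\<close> makes
  \<open>N\<close> definite and bounds the entries of a normalized vector by 1.\<close>

locale solid_matrix_norm =
  fixes X :: "(nat \<Rightarrow> nat \<Rightarrow> real) set" and N :: "(nat \<Rightarrow> nat \<Rightarrow> real) \<Rightarrow> real"
  assumes zero_mem: "(\<lambda>i j. 0) \<in> X"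
    and add_mem: "a \<in> X \<Longrightarrow> b \<in> X \<Longrightarrow> (\<lambda>i j. a i j + b i j) \<in> X"
    and N_add: "a \<in> X \<Longrightarrow> b \<in> X \<Longrightarrow> N (\<lambda>i j. a i j + b i j) \<le> N a + N b"
    and scale_mem: "a \<in> X \<Longrightarrow> (\<lambda>i j. c * a i j) \<in> X"
    and N_scale: "a \<in> X \<Longrightarrow> N (\<lambda>i j. c * a i j) = \<bar>c\<bar> * N a"
    and solid_mem: "a \<in> X \<Longrightarrow> (\<And>i j. \<bar>b i j\<bar> \<le> \<bar>a i j\<bar>) \<Longrightarrow> b \<in> X"
    and N_solid: "a \<in> X \<Longrightarrow> (\<And>i j. \<bar>b i j\<bar> \<le> \<bar>a i j\<bar>) \<Longrightarrow> N b \<le> N a"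
    and abs_entry_le: "a \<in> X \<Longrightarrow> \<bar>a i j\<bar> \<le> N a"
begin

lemma N_nonneg: "a \<in> X \<Longrightarrow> 0 \<le> N a"
  using abs_entry_le[of a 0 0] by linarith

lemma N_zero: "N (\<lambda>i j. 0) = 0"
  using N_scale[OF zero_mem, of 0] by simp

lemma diff_mem: "a \<in> X \<Longrightarrow> b \<in> X \<Longrightarrow> (\<lambda>i j. a i j - b i j) \<in> X"
  using add_mem[OF _ scale_mem[of b "-1"]] by simp

lemma minus_mem: "a \<in> X \<Longrightarrow> b \<in> X \<Longrightarrow> a - b \<in> X"
  using diff_mem by (simp add: fun_diff_def)

lemma N_diff: "a \<in> X \<Longrightarrow> b \<in> X \<Longrightarrow> N (\<lambda>i j. a i j - b i j) \<le> N a + N b"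
  using N_add[OF _ scale_mem[of b "-1"]] N_scale[of b "-1"] by simp

lemma N_triangle: "a \<in> X \<Longrightarrow> b \<in> X \<Longrightarrow> N a \<le> N b + N (a - b)"
  using N_add[of b "a - b"] minus_mem[of a b] by (simp add: fun_diff_def)

lemma sum_mem: "(\<And>k. k \<in> K \<Longrightarrow> y k \<in> X) \<Longrightarrow> (\<lambda>i j. \<Sum>k\<in>K. y k i j) \<in> X"
  by (induction K rule: infinite_finite_induct) (auto intro: zero_mem add_mem)

lemma lcomb_mem: "(\<And>k. k \<in> K \<Longrightarrow> y k \<in> X) \<Longrightarrow> lcomb K c y \<in> X"
  unfolding lcomb_def by (intro sum_mem scale_mem) auto

lemma N_sum: "(\<And>k. k \<in> K \<Longrightarrow> y k \<in> X) \<Longrightarrow> N (\<lambda>i j. \<Sum>k\<in>K. y k i j) \<le> (\<Sum>k\<in>K. N (y k))"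
proof (induction K rule: infinite_finite_induct)
  case (insert k K)
  then show ?case
    using N_add[of "y k" "\<lambda>i j. \<Sum>k\<in>K. y k i j"] sum_mem[of K y] by force
qed (simp_all add: N_zero)

lemma N_lcomb: "(\<And>k. k \<in> K \<Longrightarrow> y k \<in> X) \<Longrightarrow> N (lcomb K c y) \<le> (\<Sum>k\<in>K. \<bar>c k\<bar> * N (y k))"
  unfolding lcomb_def
  using N_sum[of K "\<lambda>k i j. c k * y k i j"] by (simp add: scale_mem N_scale)

lemma restr_mem: "a \<in> X \<Longrightarrow> restr S a \<in> X"
  by (erule solid_mem) (auto simp: restr_def)

lemma N_restr_le: "a \<in> X \<Longrightarrow> N (restr S a) \<le> N a"
  by (erule N_solid) (auto simp: restr_def)

section \<open>Averages over signs\<close>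

lemma N_convex:
  assumes "a \<in> X" "b \<in> X" "N a \<le> M" "N b \<le> M" "0 \<le> t" "t \<le> 1"
  shows "N (\<lambda>i j. t * a i j + (1 - t) * b i j) \<le> M"
proof -
  have "N (\<lambda>i j. t * a i j + (1 - t) * b i j) \<le> t * N a + (1 - t) * N b"
    using N_add[OF scale_mem[OF assms(1), of t] scale_mem[OF assms(2), of "1 - t"]] assms
    by (simp add: N_scale)
  also have "\<dots> \<le> t * M + (1 - t) * M"
    using assms by (intro add_mono mult_left_mono) auto
  finally show ?thesis by (simp add: algebra_simps)
qed

text \<open>A point of the cube [-1,1]^K is a convex combination of the vertices. One coordinate is
  split off at a time, with weights (1 + \<theta>)/2 and (1 - \<theta>)/2; \<open>z\<close> carries
  the terms whose signs are already fixed.\<close>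

lemma N_contraction_aux:
  fixes K :: "nat set"
  assumes "finite K" "\<And>k. k \<in> K \<Longrightarrow> y k \<in> X" "z \<in> X"
    and "\<And>k. k \<in> K \<Longrightarrow> \<bar>\<theta> k\<bar> \<le> 1"
    and "\<And>\<epsilon>. signs \<epsilon> \<Longrightarrow> N (\<lambda>i j. z i j + (\<Sum>k\<in>K. \<epsilon> k * y k i j)) \<le> M"
  shows "N (\<lambda>i j. z i j + (\<Sum>k\<in>K. \<theta> k * y k i j)) \<le> M"
  using assms
proof (induction K arbitrary: z rule: finite_induct)
  case empty
  then show ?case using signs_one by auto
next
  case (insert k0 K)
  have y0: "y k0 \<in> X" and \<theta>0: "\<bar>\<theta> k0\<bar> \<le> 1" using insert.prems by auto
  have IH: "N (\<lambda>i j. (z i j + s * y k0 i j) + (\<Sum>k\<in>K. \<theta> k * y k i j)) \<le> M"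
    if s: "s = 1 \<or> s = - 1" for s :: real
  proof (rule insert.IH)
    show "(\<lambda>i j. z i j + s * y k0 i j) \<in> X"
      using insert.prems y0 by (intro add_mem scale_mem)
    fix \<epsilon> :: "nat \<Rightarrow> real" assume "signs \<epsilon>"
    then have "N (\<lambda>i j. z i j + (\<Sum>k\<in>insert k0 K. (\<epsilon>(k0 := s)) k * y k i j)) \<le> M"
      using insert.prems(4) signs_upd s by blast
    moreover have "(\<Sum>k\<in>K. (\<epsilon>(k0 := s)) k * y k i j) = (\<Sum>k\<in>K. \<epsilon> k * y k i j)" for i j
      using insert.hyps by (intro sum.cong) auto
    ultimately show "N (\<lambda>i j. z i j + s * y k0 i j + (\<Sum>k\<in>K. \<epsilon> k * y k i j)) \<le> M"
      using insert.hyps by (simp add: add.assoc)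
  qed (use insert.prems in auto)
  have mem: "(\<lambda>i j. (z i j + s * y k0 i j) + (\<Sum>k\<in>K. \<theta> k * y k i j)) \<in> X" for s
    using insert.prems y0 by (intro add_mem scale_mem sum_mem) auto
  have "N (\<lambda>i j. (1 + \<theta> k0)/2 * ((z i j + 1 * y k0 i j) + (\<Sum>k\<in>K. \<theta> k * y k i j))
      + (1 - (1 + \<theta> k0)/2) * ((z i j + (-1) * y k0 i j) + (\<Sum>k\<in>K. \<theta> k * y k i j))) \<le> M"
    using \<theta>0 by (intro N_convex mem IH) auto
  moreover have "(1 + \<theta> k0)/2 * ((z i j + 1 * y k0 i j) + (\<Sum>k\<in>K. \<theta> k * y k i j))
      + (1 - (1 + \<theta> k0)/2) * ((z i j + (-1) * y k0 i j) + (\<Sum>k\<in>K. \<theta> k * y k i j))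
      = z i j + (\<Sum>k\<in>insert k0 K. \<theta> k * y k i j)" for i j
    using insert.hyps by (simp add: field_simps)
  ultimately show ?case by simp
qed

lemma N_contraction:
  fixes K :: "nat set"
  assumes "finite K" "\<And>k. k \<in> K \<Longrightarrow> y k \<in> X" "\<And>k. k \<in> K \<Longrightarrow> \<bar>\<theta> k\<bar> \<le> 1"
    and "\<And>\<epsilon>. signs \<epsilon> \<Longrightarrow> N (lcomb K (\<lambda>k. \<epsilon> k * c k) y) \<le> M"
  shows "N (lcomb K (\<lambda>k. \<theta> k * c k) y) \<le> M"
  using N_contraction_aux[of K "\<lambda>k i j. c k * y k i j" "\<lambda>i j. 0" \<theta> M] assms
  by (simp add: lcomb_def zero_mem scale_mem mult.assoc)

text \<open>Averaging over the signs kills the off-diagonal terms.\<close>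

lemma N_diagonal_aux:
  fixes K :: "nat set"
  assumes "finite K" "\<And>k l. k \<in> K \<Longrightarrow> l \<in> K \<Longrightarrow> u k l \<in> X" "z \<in> X"
    and "\<And>\<epsilon>. signs \<epsilon> \<Longrightarrow> N (\<lambda>i j. z i j + (\<Sum>k\<in>K. \<Sum>l\<in>K. \<epsilon> k * \<epsilon> l * u k l i j)) \<le> M"
  shows "N (\<lambda>i j. z i j + (\<Sum>k\<in>K. u k k i j)) \<le> M"
  using assms
proof (induction K arbitrary: z rule: finite_induct)
  case empty
  then show ?case using signs_one by auto
next
  case (insert k0 K)
  have "N (\<lambda>i j. (z i j + u k0 k0 i j) + (\<Sum>k\<in>K. u k k i j)) \<le> M"
  proof (rule insert.IH)
    show "(\<lambda>i j. z i j + u k0 k0 i j) \<in> X" using insert.prems by (intro add_mem) auto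
    fix \<epsilon> :: "nat \<Rightarrow> real" assume \<epsilon>: "signs \<epsilon>"
    \<comment> \<open>As a function of the sign s at \<open>k0\<close>, the double sum is P + s Q:
      the diagonal term at \<open>k0\<close> belongs to \<open>P\<close> because s * s = 1, and the
      cross terms with \<open>k0\<close> form \<open>Q\<close>. The average over s = 1 and s = -1 is
      \<open>P\<close>.\<close>
    define P where "P i j = z i j + u k0 k0 i j + (\<Sum>k\<in>K. \<Sum>l\<in>K. \<epsilon> k * \<epsilon> l * u k l i j)" for i j
    define Q where "Q i j = (\<Sum>l\<in>K. \<epsilon> l * (u k0 l i j + u l k0 i j))" for i j
    have eq: "z i j + (\<Sum>k\<in>insert k0 K. \<Sum>l\<in>insert k0 K. (\<epsilon>(k0 := s)) k * (\<epsilon>(k0 := s)) l * u k l i j)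
        = P i j + s * Q i j" if "s = 1 \<or> s = -1" for s i j
    proof -
      have 1: "(\<Sum>l\<in>K. s * (\<epsilon>(k0 := s)) l * u k0 l i j) = (\<Sum>l\<in>K. s * \<epsilon> l * u k0 l i j)"
        using insert.hyps by (intro sum.cong) auto
      have 2: "(\<Sum>k\<in>K. (\<epsilon>(k0 := s)) k * s * u k k0 i j) = (\<Sum>k\<in>K. \<epsilon> k * s * u k k0 i j)"
        using insert.hyps by (intro sum.cong) auto
      have 3: "(\<Sum>k\<in>K. \<Sum>l\<in>K. (\<epsilon>(k0 := s)) k * (\<epsilon>(k0 := s)) l * u k l i j)
          = (\<Sum>k\<in>K. \<Sum>l\<in>K. \<epsilon> k * \<epsilon> l * u k l i j)"
        using insert.hyps by (intro sum.cong refl) auto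
      have "(\<Sum>k\<in>insert k0 K. \<Sum>l\<in>insert k0 K. (\<epsilon>(k0 := s)) k * (\<epsilon>(k0 := s)) l * u k l i j)
        = s * s * u k0 k0 i j + (\<Sum>l\<in>K. s * \<epsilon> l * u k0 l i j)
          + (\<Sum>k\<in>K. \<epsilon> k * s * u k k0 i j) + (\<Sum>k\<in>K. \<Sum>l\<in>K. \<epsilon> k * \<epsilon> l * u k l i j)"
        unfolding 1[symmetric] 2[symmetric] 3[symmetric]
        using insert.hyps by (simp add: sum.distrib)
      moreover have "s * s = 1" using that by auto
      ultimately show ?thesis
        unfolding P_def Q_def by (simp add: algebra_simps sum.distrib sum_distrib_left)
    qed
    have PQ: "N (\<lambda>i j. P i j + s * Q i j) \<le> M" if "s = 1 \<or> s = -1" for s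
      using insert.prems(3)[of "\<epsilon>(k0 := s)"] signs_upd[OF \<epsilon> that] unfolding eq[OF that] by blast
    have P: "P \<in> X" and Q: "Q \<in> X"
      unfolding P_def Q_def using insert.prems
      by (auto intro!: add_mem scale_mem sum_mem)
    have "N (\<lambda>i j. 1/2 * (P i j + 1 * Q i j) + (1 - 1/2) * (P i j + (-1) * Q i j)) \<le> M"
      using P Q PQ by (intro N_convex add_mem scale_mem PQ) auto
    moreover have "1/2 * (P i j + 1 * Q i j) + (1 - 1/2) * (P i j + (-1) * Q i j) = P i j" for i j
      by (simp add: field_simps)
    ultimately show "N (\<lambda>i j. z i j + u k0 k0 i j + (\<Sum>k\<in>K. \<Sum>l\<in>K. \<epsilon> k * \<epsilon> l * u k l i j)) \<le> M"
      by (simp add: P_def)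
  qed (use insert.prems in auto)
  then show ?case using insert.hyps by (simp add: add.assoc)
qed

lemma N_diagonal:
  fixes K :: "nat set"
  assumes "finite K" "\<And>k l. k \<in> K \<Longrightarrow> l \<in> K \<Longrightarrow> u k l \<in> X"
    and "\<And>\<epsilon>. signs \<epsilon> \<Longrightarrow> N (\<lambda>i j. \<Sum>k\<in>K. \<Sum>l\<in>K. \<epsilon> k * \<epsilon> l * u k l i j) \<le> M"
  shows "N (\<lambda>i j. \<Sum>k\<in>K. u k k i j) \<le> M"
  using N_diagonal_aux[of K u "\<lambda>i j. 0" M] assms by (simp add: zero_mem)

text \<open>The diagonal argument for the matrix \<open>restr (S k) (y l)\<close>: on
  \<open>S k\<close> its signed double sum equals, up to the sign \<open>\<epsilon> k\<close>, the
  entry of \<open>lcomb K \<epsilon> y\<close>, so solidity applies. Each \<open>y k\<close> can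
  thus be cut down to its own set although the other vectors may also live there.\<close>

lemma N_restr_diagonal:
  fixes K :: "nat set"
  assumes "finite K" "\<And>k. k \<in> K \<Longrightarrow> y k \<in> X" "disjoint_family_on S K"
    and le: "\<And>\<epsilon>. signs \<epsilon> \<Longrightarrow> N (lcomb K \<epsilon> y) \<le> M"
  shows "N (\<lambda>i j. \<Sum>k\<in>K. restr (S k) (y k) i j) \<le> M"
proof (rule N_diagonal[where u = "\<lambda>k l. restr (S k) (y l)"])
  fix \<epsilon> :: "nat \<Rightarrow> real" assume \<epsilon>: "signs \<epsilon>"
  have "N (\<lambda>i j. \<Sum>k\<in>K. \<Sum>l\<in>K. \<epsilon> k * \<epsilon> l * restr (S k) (y l) i j) \<le> N (lcomb K \<epsilon> y)"
  proof (rule N_solid)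
    fix i j
    have eq: "(\<Sum>k\<in>K. \<Sum>l\<in>K. \<epsilon> k * \<epsilon> l * restr (S k) (y l) i j)
        = (\<Sum>k\<in>K. if (i, j) \<in> S k then \<epsilon> k * lcomb K \<epsilon> y i j else 0)"
      by (intro sum.cong) (auto simp: restr_def lcomb_def sum_distrib_left mult.assoc)
    show "\<bar>\<Sum>k\<in>K. \<Sum>l\<in>K. \<epsilon> k * \<epsilon> l * restr (S k) (y l) i j\<bar> \<le> \<bar>lcomb K \<epsilon> y i j\<bar>"
    proof (cases "\<exists>k\<in>K. (i, j) \<in> S k")
      case True
      then obtain k where k: "k \<in> K" "(i, j) \<in> S k" by auto
      then have "(i, j) \<notin> S l" if "l \<in> K" "l \<noteq> k" for l
        using assms(3) that by (auto simp: disjoint_family_on_def)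
      then have "(\<Sum>k\<in>K. if (i, j) \<in> S k then \<epsilon> k * lcomb K \<epsilon> y i j else 0)
          = (\<Sum>k\<in>{k}. if (i, j) \<in> S k then \<epsilon> k * lcomb K \<epsilon> y i j else 0)"
        using k assms(1) by (intro sum.mono_neutral_right) auto
      then show ?thesis
        unfolding eq using k \<epsilon>[unfolded signs_def, rule_format, of k] by (auto simp: abs_mult)
    next
      case False
      then have "(\<Sum>k\<in>K. if (i, j) \<in> S k then \<epsilon> k * lcomb K \<epsilon> y i j else 0) = 0"
        by (intro sum.neutral) auto
      then show ?thesis unfolding eq by simp
    qed
  qed (use assms lcomb_mem in auto)
  then show "N (\<lambda>i j. \<Sum>k\<in>K. \<Sum>l\<in>K. \<epsilon> k * \<epsilon> l * restr (S k) (y l) i j) \<le> M"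
    using le[OF \<epsilon>] by linarith
qed (use assms restr_mem in auto)

end

section \<open>Unconditional bases\<close>

definition coef :: "((nat \<Rightarrow> nat \<Rightarrow> real) \<Rightarrow> real) \<Rightarrow> (nat \<Rightarrow> nat \<Rightarrow> nat \<Rightarrow> real)
    \<Rightarrow> (nat \<Rightarrow> nat \<Rightarrow> real) \<Rightarrow> nat \<Rightarrow> real" where
  "coef N x y = (THE c. expands N x y c)"

text \<open>The two instances are columns (\<open>R = UNIV\<close>, \<open>lev = snd\<close>) and
  rows inside the first n columns (\<open>R = {(i, j). j < n}\<close>,
  \<open>lev = fst\<close>).\<close>

definition levset :: "(nat \<times> nat) set \<Rightarrow> (nat \<times> nat \<Rightarrow> nat) \<Rightarrow> nat set \<Rightarrow> (nat \<times> nat) set" where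
  "levset R lev J = {s \<in> R. lev s \<in> J}"

lemma (in solid_matrix_norm) expands_lcomb:
  assumes "finite K" shows "expands N x (lcomb K c x) (\<lambda>k. if k \<in> K then c k else 0)"
proof -
  obtain n0 where n0: "\<And>k. k \<in> K \<Longrightarrow> k < n0"
    using assms unfolding finite_nat_set_iff_bounded by auto
  have "N (lcomb K c x - lcomb {..<n} (\<lambda>k. if k \<in> K then c k else 0) x) = 0" if "n \<ge> n0" for n
  proof -
    have "K \<subseteq> {..<n}" using n0 that by (auto intro: less_le_trans)
    then have "(\<Sum>k<n. (if k \<in> K then c k else 0) * x k i j) = (\<Sum>k\<in>K. c k * x k i j)" for i j
      by (rule sum.mono_neutral_cong_right[OF finite_lessThan]) auto
    then have "lcomb K c x - lcomb {..<n} (\<lambda>k. if k \<in> K then c k else 0) x = (\<lambda>i j. 0)"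
      by (simp add: fun_eq_iff lcomb_def)
    then show ?thesis using N_zero by simp
  qed
  then show ?thesis unfolding expands_def
    by (intro tendsto_eventually eventually_sequentiallyI[of n0]) auto
qed

locale unconditional_matrix_basis = solid_matrix_norm +
  fixes x :: "nat \<Rightarrow> nat \<Rightarrow> nat \<Rightarrow> real"
  assumes basis: "schauder_basis X N x"
    and norm_basis [simp]: "\<And>k. N (x k) = 1"
    and unc: "unconditional N x"
begin

abbreviation cf where "cf \<equiv> coef N x"

lemma x_mem [simp]: "x k \<in> X"
  using basis by (auto simp: schauder_basis_def)

lemma lcomb_x_mem [simp]: "lcomb K c x \<in> X"
  by (intro lcomb_mem) auto

lemma expands_cf: "y \<in> X \<Longrightarrow> expands N x y (cf y)"
  unfolding coef_def using basis by (intro theI'[of "expands N x y"]) (auto simp: schauder_basis_def)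

lemma cf_eqI: "y \<in> X \<Longrightarrow> expands N x y c \<Longrightarrow> cf y = c"
  unfolding coef_def using basis by (intro the1_equality) (auto simp: schauder_basis_def)

lemma cf_add:
  assumes "y \<in> X" "z \<in> X" shows "cf (\<lambda>i j. y i j + z i j) k = cf y k + cf z k"
proof -
  let ?d = "\<lambda>n. lcomb {..<n} (\<lambda>k. cf y k + cf z k) x"
  have eq: "(\<lambda>i j. y i j + z i j) - ?d n =
      (\<lambda>i j. (y - lcomb {..<n} (cf y) x) i j + (z - lcomb {..<n} (cf z) x) i j)" for n
    by (auto simp: fun_eq_iff lcomb_def algebra_simps sum.distrib)
  have lim: "(\<lambda>n. N (y - lcomb {..<n} (cf y) x) + N (z - lcomb {..<n} (cf z) x)) \<longlonglongrightarrow> 0"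
    using tendsto_add[OF expands_cf[OF assms(1), unfolded expands_def]
        expands_cf[OF assms(2), unfolded expands_def]] by simp
  have "expands N x (\<lambda>i j. y i j + z i j) (\<lambda>k. cf y k + cf z k)"
    unfolding expands_def
    unfolding eq
    by (rule real_tendsto_sandwich[OF always_eventually always_eventually tendsto_const lim])
      (intro allI N_nonneg N_add add_mem minus_mem assms lcomb_x_mem)+
  then show ?thesis using cf_eqI[OF add_mem[OF assms]] by simp
qed

lemma cf_scale:
  assumes "y \<in> X" shows "cf (\<lambda>i j. c * y i j) k = c * cf y k"
proof -
  let ?d = "\<lambda>n. lcomb {..<n} (\<lambda>k. c * cf y k) x"
  have eq: "(\<lambda>i j. c * y i j) - ?d n = (\<lambda>i j. c * (y - lcomb {..<n} (cf y) x) i j)" for n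
    by (auto simp: fun_eq_iff lcomb_def algebra_simps sum_distrib_left)
  have "expands N x (\<lambda>i j. c * y i j) (\<lambda>k. c * cf y k)"
    using tendsto_mult_left[OF expands_cf[OF assms, unfolded expands_def], of "\<bar>c\<bar>"]
    unfolding expands_def by (simp add: eq N_scale minus_mem assms del: minus_apply)
  then show ?thesis using cf_eqI[OF scale_mem[OF assms]] by simp
qed

lemma cf_diff:
  assumes "y \<in> X" "z \<in> X" shows "cf (\<lambda>i j. y i j - z i j) k = cf y k - cf z k"
  using cf_add[OF assms(1) scale_mem[OF assms(2), of "-1"], of k] cf_scale[OF assms(2), of "-1"]
  by simp

lemma cf_zero: "cf (\<lambda>i j. 0) k = 0"
  using cf_scale[OF zero_mem, of 0] by simp

lemma cf_sum:
  assumes "\<And>l. l \<in> K \<Longrightarrow> u l \<in> X"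
  shows "cf (\<lambda>i j. \<Sum>l\<in>K. u l i j) k = (\<Sum>l\<in>K. cf (u l) k)"
  using assms
  by (induction K rule: infinite_finite_induct) (simp_all add: cf_zero cf_add sum_mem)

lemma cf_lcomb_gen:
  assumes "\<And>l. l \<in> K \<Longrightarrow> u l \<in> X"
  shows "cf (lcomb K c u) k = (\<Sum>l\<in>K. c l * cf (u l) k)"
  unfolding lcomb_def using cf_sum[of K "\<lambda>l i j. c l * u l i j"] assms
  by (simp add: scale_mem cf_scale)

lemma cf_lcomb: "finite K \<Longrightarrow> cf (lcomb K c x) = (\<lambda>k. if k \<in> K then c k else 0)"
  by (intro cf_eqI expands_lcomb) auto

section \<open>Sign changes and bounded coefficients\<close>

text \<open>\<open>unconditional\<close> speaks of sums over initial segments only. The bound passes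
  to an arbitrary finite \<open>K\<close> by averaging two sign patterns, and to an arbitrary
  \<open>y\<close> by letting its partial sums converge. With a singleton \<open>K\<close> it bounds
  the coefficient functionals.\<close>

lemma unconditional_expansion_bound:
  "\<exists>D\<ge>1. \<forall>y K \<epsilon>. y \<in> X \<longrightarrow> finite K \<longrightarrow> signs \<epsilon> \<longrightarrow> N (lcomb K (\<lambda>k. \<epsilon> k * cf y k) x) \<le> D * N y"
proof -
  obtain C where C: "\<And>n a \<epsilon>. signs \<epsilon> \<Longrightarrow>
      N (lcomb {..<n} (\<lambda>i. \<epsilon> i * a i) x) \<le> C * N (lcomb {..<n} a x)"
    using unc unfolding unconditional_def signs_def by metis
  have "N (lcomb K (\<lambda>k. \<epsilon> k * cf y k) x) \<le> max 1 C * N y"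
    if y: "y \<in> X" and K: "finite K" and \<epsilon>: "signs \<epsilon>" for y K \<epsilon>
  proof (rule LIMSEQ_le_const)
    let ?S = "\<lambda>n. lcomb {..<n} (cf y) x"
    have "(\<lambda>n. max 1 C * (N y + N (y - ?S n))) \<longlonglongrightarrow> max 1 C * (N y + 0)"
      by (intro tendsto_intros expands_cf[OF y, unfolded expands_def])
    then show "(\<lambda>n. max 1 C * (N y + N (y - ?S n))) \<longlonglongrightarrow> max 1 C * N y" by simp
    obtain n0 where n0: "\<And>k. k \<in> K \<Longrightarrow> k < n0"
      using K unfolding finite_nat_set_iff_bounded by auto
    have "N (lcomb K (\<lambda>k. \<epsilon> k * cf y k) x) \<le> max 1 C * (N y + N (y - ?S n))" if n: "n \<ge> n0" for n
    proof -
      have S: "N (?S n) \<le> N y + N (y - ?S n)"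
        using N_diff[OF y minus_mem[OF y, of "?S n"]] by simp
      have sub: "K \<subseteq> {..<n}" using n0 n by (auto intro: less_le_trans)
      \<comment> \<open>These signs agree with \<open>\<epsilon>\<close> on \<open>K\<close> and are
        constant outside; averaging the constants 1 and -1 removes the terms outside
        \<open>K\<close>. The factor \<open>max 1 C\<close> is positive whatever the sign of
        \<open>C\<close>.\<close>
      let ?e = "\<lambda>s k. if k \<in> K then \<epsilon> k else s"
      have b: "N (lcomb {..<n} (\<lambda>k. ?e s k * cf y k) x) \<le> max 1 C * N (?S n)" if "s = 1 \<or> s = -1" for s
      proof -
        have "signs (?e s)" using \<epsilon> that by (auto simp: signs_def)
        then have "N (lcomb {..<n} (\<lambda>k. ?e s k * cf y k) x) \<le> C * N (?S n)" by (rule C)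
        also have "\<dots> \<le> max 1 C * N (?S n)" by (intro mult_right_mono N_nonneg) auto
        finally show ?thesis .
      qed
      have "N (\<lambda>i j. 1/2 * lcomb {..<n} (\<lambda>k. ?e 1 k * cf y k) x i j
          + (1 - 1/2) * lcomb {..<n} (\<lambda>k. ?e (-1) k * cf y k) x i j) \<le> max 1 C * N (?S n)"
        using b by (intro N_convex) auto
      moreover have "1/2 * lcomb {..<n} (\<lambda>k. ?e 1 k * cf y k) x i j
          + (1 - 1/2) * lcomb {..<n} (\<lambda>k. ?e (-1) k * cf y k) x i j
          = lcomb K (\<lambda>k. \<epsilon> k * cf y k) x i j" for i j
      proof -
        have "1/2 * lcomb {..<n} (\<lambda>k. ?e 1 k * cf y k) x i j
          + (1 - 1/2) * lcomb {..<n} (\<lambda>k. ?e (-1) k * cf y k) x i j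
          = (\<Sum>k<n. 1/2 * (?e 1 k * cf y k * x k i j) + 1/2 * (?e (-1) k * cf y k * x k i j))"
          by (simp add: lcomb_def sum.distrib sum_distrib_left)
        also have "\<dots> = (\<Sum>k\<in>K. \<epsilon> k * cf y k * x k i j)"
          by (rule sum.mono_neutral_cong_right[OF finite_lessThan sub]) auto
        finally show ?thesis by (simp add: lcomb_def)
      qed
      ultimately have "N (lcomb K (\<lambda>k. \<epsilon> k * cf y k) x) \<le> max 1 C * N (?S n)" by simp
      also have "\<dots> \<le> max 1 C * (N y + N (y - ?S n))"
        using S by (intro mult_left_mono) auto
      finally show ?thesis .
    qed
    then show "\<exists>n0. \<forall>n\<ge>n0. N (lcomb K (\<lambda>k. \<epsilon> k * cf y k) x) \<le> max 1 C * (N y + N (y - ?S n))"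
      by blast
  qed
  then show ?thesis by (intro exI[of _ "max 1 C"]) auto
qed

text \<open>Chosen once, so that all later estimates share one constant.\<close>

definition unc_const where "unc_const = (SOME D. D \<ge> 1 \<and> (\<forall>y K \<epsilon>. y \<in> X \<longrightarrow> finite K \<longrightarrow> signs \<epsilon> \<longrightarrow>
  N (lcomb K (\<lambda>k. \<epsilon> k * cf y k) x) \<le> D * N y))"

lemma unc_const_ge_1: "1 \<le> unc_const"
  and N_signed_expansion_le: "y \<in> X \<Longrightarrow> finite K \<Longrightarrow> signs \<epsilon> \<Longrightarrow> N (lcomb K (\<lambda>k. \<epsilon> k * cf y k) x) \<le> unc_const * N y"
proof -
  have "unc_const \<ge> 1 \<and> (\<forall>y K \<epsilon>. y \<in> X \<longrightarrow> finite K \<longrightarrow> signs \<epsilon> \<longrightarrow>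
      N (lcomb K (\<lambda>k. \<epsilon> k * cf y k) x) \<le> unc_const * N y)"
    unfolding unc_const_def by (rule someI_ex) (use unconditional_expansion_bound in blast)
  then show "1 \<le> unc_const" "y \<in> X \<Longrightarrow> finite K \<Longrightarrow> signs \<epsilon> \<Longrightarrow> N (lcomb K (\<lambda>k. \<epsilon> k * cf y k) x) \<le> unc_const * N y"
    by auto
qed

lemma abs_cf_le: assumes "y \<in> X" shows "\<bar>cf y k\<bar> \<le> unc_const * N y"
proof -
  have "N (\<lambda>i j. cf y k * x k i j) \<le> unc_const * N y"
    using N_signed_expansion_le[OF assms, of "{k}" "\<lambda>k. 1"] signs_one by (simp add: lcomb_def)
  then show ?thesis by (simp add: N_scale)
qed

lemma N_signed_lcomb_le:
  assumes "finite K" "signs \<epsilon>" shows "N (lcomb K (\<lambda>k. \<epsilon> k * c k) x) \<le> unc_const * N (lcomb K c x)"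
proof -
  have "lcomb K (\<lambda>k. \<epsilon> k * cf (lcomb K c x) k) x = lcomb K (\<lambda>k. \<epsilon> k * c k) x"
    unfolding cf_lcomb[OF assms(1)] by (simp add: lcomb_def cong: sum.cong)
  then show ?thesis using N_signed_expansion_le[OF lcomb_x_mem[of K c] assms] by simp
qed

lemma N_contracted_lcomb_le:
  assumes "finite K" "\<And>k. k \<in> K \<Longrightarrow> \<bar>\<theta> k\<bar> \<le> 1"
  shows "N (lcomb K (\<lambda>k. \<theta> k * c k) x) \<le> unc_const * N (lcomb K c x)"
  by (rule N_contraction[OF assms(1), where \<theta> = \<theta> and c = c])
    (rule x_mem assms(2) N_signed_lcomb_le[OF assms(1)]; assumption)+

text \<open>The matrix is \<open>cf (v l) k * x k\<close>. Its signed double sum is the part on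
  \<open>K\<close> of the expansion of \<open>lcomb K \<epsilon> v\<close> with its coefficients
  multiplied by the signs \<open>\<epsilon>\<close>, and unconditionality controls it; averaging
  retains the diagonal.\<close>

lemma N_cf_diagonal:
  assumes K: "finite K" and v: "\<And>k. k \<in> K \<Longrightarrow> v k \<in> X"
    and le: "\<And>\<epsilon>. signs \<epsilon> \<Longrightarrow> N (lcomb K \<epsilon> v) \<le> M"
  shows "N (lcomb K (\<lambda>k. cf (v k) k) x) \<le> unc_const * M"
  unfolding lcomb_def
proof (rule N_diagonal[OF K, where u = "\<lambda>k l i j. cf (v l) k * x k i j"])
  fix \<epsilon> :: "nat \<Rightarrow> real" assume \<epsilon>: "signs \<epsilon>"
  have "(\<Sum>k\<in>K. \<Sum>l\<in>K. \<epsilon> k * \<epsilon> l * (cf (v l) k * x k i j)) = lcomb K (\<lambda>k. \<epsilon> k * cf (lcomb K \<epsilon> v) k) x i j" for i j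
  proof -
    have "cf (lcomb K \<epsilon> v) k = (\<Sum>l\<in>K. \<epsilon> l * cf (v l) k)" for k
      by (rule cf_lcomb_gen) (use v in auto)
    then show ?thesis
      by (simp add: lcomb_def sum_distrib_left sum_distrib_right mult_ac)
  qed
  moreover have "N (lcomb K (\<lambda>k. \<epsilon> k * cf (lcomb K \<epsilon> v) k) x) \<le> unc_const * N (lcomb K \<epsilon> v)"
    by (rule N_signed_expansion_le) (use K \<epsilon> v lcomb_mem in auto)
  moreover have "unc_const * N (lcomb K \<epsilon> v) \<le> unc_const * M"
    using le[OF \<epsilon>] unc_const_ge_1 by (intro mult_left_mono) auto
  ultimately show "N (\<lambda>i j. \<Sum>k\<in>K. \<Sum>l\<in>K. \<epsilon> k * \<epsilon> l * (cf (v l) k * x k i j)) \<le> unc_const * M"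
    by simp
qed (intro scale_mem x_mem)

text \<open>This is what allows one to throw away parts of the basis vectors.\<close>

lemma N_lcomb_le_if_cf_ge:
  assumes K: "finite K" and v: "\<And>k. k \<in> K \<Longrightarrow> v k \<in> X"
    and \<delta>: "0 < \<delta>" "\<And>k. k \<in> K \<Longrightarrow> \<delta> \<le> \<bar>cf (v k) k\<bar>"
    and le: "\<And>\<epsilon>. signs \<epsilon> \<Longrightarrow> N (lcomb K (\<lambda>k. \<epsilon> k * c k) v) \<le> M"
  shows "N (lcomb K c x) \<le> unc_const * unc_const / \<delta> * M"
proof -
  have "N (lcomb K (\<lambda>k. cf (\<lambda>i j. c k * v k i j) k) x) \<le> unc_const * M"
  proof (rule N_cf_diagonal[OF K, where v = "\<lambda>k i j. c k * v k i j"])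
    fix \<epsilon> :: "nat \<Rightarrow> real" assume "signs \<epsilon>"
    from le[OF this] show "N (lcomb K \<epsilon> (\<lambda>k i j. c k * v k i j)) \<le> M"
      by (simp add: lcomb_def mult.assoc)
  qed (intro scale_mem v)
  moreover have "lcomb K (\<lambda>k. cf (\<lambda>i j. c k * v k i j) k) x = lcomb K (\<lambda>k. c k * cf (v k) k) x"
    using v by (simp add: lcomb_def cf_scale cong: sum.cong)
  ultimately have 1: "N (lcomb K (\<lambda>k. c k * cf (v k) k) x) \<le> unc_const * M" by simp
  \<comment> \<open>The multipliers \<open>\<delta> / cf (v k) k\<close> have modulus at most 1 and
    turn the diagonal coefficients into the constant \<open>\<delta>\<close>. This second use of
    unconditionality accounts for the square of \<open>unc_const\<close>.\<close>
  have "N (lcomb K (\<lambda>k. \<delta> / cf (v k) k * (c k * cf (v k) k)) x) \<le> unc_const * N (lcomb K (\<lambda>k. c k * cf (v k) k) x)"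
  proof (intro N_contracted_lcomb_le K)
    fix k assume "k \<in> K"
    then show "\<bar>\<delta> / cf (v k) k\<bar> \<le> 1"
      using \<delta>(2)[of k] \<delta>(1) by (simp add: abs_divide divide_le_eq)
  qed
  also have "\<dots> \<le> unc_const * (unc_const * M)" using 1 unc_const_ge_1 by (intro mult_left_mono) auto
  also have "lcomb K (\<lambda>k. \<delta> / cf (v k) k * (c k * cf (v k) k)) x = (\<lambda>i j. \<delta> * lcomb K c x i j)"
    unfolding lcomb_def sum_distrib_left
  proof (intro ext sum.cong refl)
    fix i j k assume "k \<in> K"
    then have "cf (v k) k \<noteq> 0" using \<delta> by force
    then show "\<delta> / cf (v k) k * (c k * cf (v k) k) * x k i j = \<delta> * (c k * x k i j)" by simp
  qed
  finally show ?thesis using \<delta>(1) by (simp add: N_scale field_simps)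
qed

end

section \<open>Blocks on disjoint levels\<close>

lemma disjoint_family_intervals:
  fixes lo hi :: "nat \<Rightarrow> nat"
  assumes "\<And>m. lo m \<le> hi m" "\<And>m. hi m \<le> lo (Suc m)"
  shows "disjoint_family (\<lambda>m. {lo m..<hi m})"
proof -
  have le: "hi m \<le> lo n" if "m < n" for m n
    using that
  proof (induction n)
    case (Suc n)
    then show ?case
      using assms(1)[of n] assms(2)[of n] by (cases "m = n") (auto intro: order_trans)
  qed simp
  show ?thesis unfolding disjoint_family_on_def
  proof (intro ballI impI)
    fix m n :: nat assume "m \<noteq> n"
    then consider "m < n" | "n < m" by linarith
    then show "{lo m..<hi m} \<inter> {lo n..<hi n} = {}"
      using le[of m n] le[of n m] by cases auto
  qed
qed

lemma ex_index_disjoint_family: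
  assumes "disjoint_family K" shows "\<exists>idx. \<forall>m. \<forall>k\<in>K m. idx k = m"
proof (intro exI allI ballI)
  fix m k assume "k \<in> K m"
  then show "(THE m. k \<in> K m) = m"
    using assms by (intro the_equality) (auto simp: disjoint_family_on_def)
qed

text \<open>Lets a sequence of blocks be read as one coefficient sequence over the basis:
  \<open>idx\<close> recovers the block of a basis index.\<close>

lemma sum_UN_index:
  assumes "disjoint_family K" "\<And>m. finite (K m)" "\<And>m k. k \<in> K m \<Longrightarrow> idx k = m"
  shows "(\<Sum>k\<in>(\<Union>m<M. K m). F (idx k) k) = (\<Sum>m<M::nat. \<Sum>k\<in>K m. F m k :: real)"
proof -
  have "(\<Sum>k\<in>(\<Union>m<M. K m). F (idx k) k) = (\<Sum>m<M. \<Sum>k\<in>K m. F (idx k) k)"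
    using assms(1,2) by (intro sum.UNION_disjoint) (auto simp: disjoint_family_on_def)
  also have "\<dots> = (\<Sum>m<M. \<Sum>k\<in>K m. F m k)"
    by (intro sum.cong refl) (simp add: assms(3))
  finally show ?thesis .
qed

context solid_matrix_norm begin

section \<open>Level systems\<close>

text \<open>Vectors carried by disjoint groups of levels behave like multiples of the unit vectors
  of \<open>g\<close>. Groups are needed because a hump occupies an interval of levels and a
  difference of two unit vectors occupies two.\<close>

definition level_estimate :: "exponent \<Rightarrow> (nat \<times> nat) set \<Rightarrow> (nat \<times> nat \<Rightarrow> nat) \<Rightarrow> real \<Rightarrow> real \<Rightarrow> bool" where
  "level_estimate g R lev c C \<longleftrightarrow> (\<forall>J M a v. disjoint_family J \<longrightarrow>
      (\<forall>m. v m \<in> X \<and> restr (levset R lev (J m)) (v m) = v m) \<longrightarrow>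
      c * unit_norm g M (\<lambda>m. a m * N (v m)) \<le> N (lcomb {..<M} a v) \<and>
      N (lcomb {..<M} a v) \<le> C * unit_norm g M (\<lambda>m. a m * N (v m)))"

text \<open>The tail condition lets a hump be stopped at a finite level with small loss.\<close>

definition level_system :: "exponent \<Rightarrow> (nat \<times> nat) set \<Rightarrow> (nat \<times> nat \<Rightarrow> nat) \<Rightarrow> bool" where
  "level_system g R lev \<longleftrightarrow> banach_exponent g \<and> (\<exists>c>0. \<exists>C>0. level_estimate g R lev c C) \<and>
    (\<forall>y\<in>X. (\<lambda>L. N (restr (levset R lev {L..}) y)) \<longlonglongrightarrow> 0)"

lemma level_estimate_lower:
  assumes "level_estimate g R lev c C" "disjoint_family J" "\<And>m. v m \<in> X"
    "\<And>m. restr (levset R lev (J m)) (v m) = v m"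
  shows "c * unit_norm g M (\<lambda>m. a m * N (v m)) \<le> N (lcomb {..<M} a v)"
  using assms unfolding level_estimate_def by blast

lemma level_estimate_upper:
  assumes "level_estimate g R lev c C" "disjoint_family J" "\<And>m. v m \<in> X"
    "\<And>m. restr (levset R lev (J m)) (v m) = v m"
  shows "N (lcomb {..<M} a v) \<le> C * unit_norm g M (\<lambda>m. a m * N (v m))"
  using assms unfolding level_estimate_def by blast

lemma level_system_exponent: "level_system g R lev \<Longrightarrow> banach_exponent g"
  by (simp add: level_system_def)

lemma level_system_tail:
  "level_system g R lev \<Longrightarrow> y \<in> X \<Longrightarrow> (\<lambda>L. N (restr (levset R lev {L..}) y)) \<longlonglongrightarrow> 0"
  by (simp add: level_system_def)

lemma restr_restr: "restr S (restr T y) = restr (S \<inter> T) y"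
  by (auto simp: restr_def fun_eq_iff)

end

lemma disjoint_family_levset: "disjoint_family J \<Longrightarrow> disjoint_family (\<lambda>m. levset R lev (J m))"
  by (auto simp: disjoint_family_on_def levset_def)

context unconditional_matrix_basis begin

text \<open>Single vectors yield subsequences; longer blocks serve to approximate given vectors when
  exponents are compared. Since parts of the individual \<open>x k\<close> are thrown away,
  \<open>\<delta>\<close> is imposed on every \<open>k\<close> in \<open>K m\<close> and not on the
  block as a whole.\<close>

theorem equiv_unit_basis_blocks:
  assumes g: "level_system g R lev" and J: "disjoint_family J"
    and K: "disjoint_family K" "\<And>m. finite (K m)"
    and \<delta>: "0 < \<delta>" "\<And>m k. k \<in> K m \<Longrightarrow> \<delta> \<le> \<bar>cf (restr (levset R lev (J m)) (x k)) k\<bar>"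
    and b: "0 < \<alpha>" "\<And>m. \<alpha> \<le> N (lcomb (K m) (t m) x)" "\<And>m. N (lcomb (K m) (t m) x) \<le> \<beta>"
  shows "equiv_unit_basis N (\<lambda>m. lcomb (K m) (t m) x) g"
proof -
  have ge: "banach_exponent g" using level_system_exponent[OF g] .
  obtain c C where c: "0 < c" and C: "0 < C" and est: "level_estimate g R lev c C"
    using g unfolding level_system_def by blast
  define S where "S m = levset R lev (J m)" for m
  have Sdisj: "disjoint_family S" unfolding S_def using disjoint_family_levset[OF J] .
  have restrS: "restr (levset R lev (J m)) (restr (S m) y) = restr (S m) y" for m y
    by (auto simp: S_def restr_restr)
  obtain idx where idx: "\<And>m k. k \<in> K m \<Longrightarrow> idx k = m"
    using ex_index_disjoint_family[OF K(1)] by blast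
  define b where "b m = lcomb (K m) (t m) x" for m
  define y where "y \<epsilon> m = lcomb (K m) (\<lambda>k. \<epsilon> k * t m k) x" for \<epsilon> m
  have bX: "b m \<in> X" and yX: "y \<epsilon> m \<in> X" for \<epsilon> m by (simp_all add: b_def y_def)
  have Ny: "N (y \<epsilon> m) \<le> unc_const * N (b m)" if "signs \<epsilon>" for \<epsilon> m
    unfolding y_def b_def by (rule N_signed_lcomb_le[OF K(2) that])
  \<comment> \<open>Flattening makes the individual \<open>x k\<close> accessible, so that their
    signs can be changed inside the blocks.\<close>
  have flat: "lcomb (\<Union>m<M. K m) (\<lambda>k. a (idx k) * t (idx k) k) x = lcomb {..<M} a b" for M a
  proof (intro ext)
    fix i j
    have "lcomb (\<Union>m<M. K m) (\<lambda>k. a (idx k) * t (idx k) k) x i j = (\<Sum>m<M. \<Sum>k\<in>K m. (a m * t m k) * x k i j)"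
      unfolding lcomb_def by (rule sum_UN_index[OF K idx])
    also have "\<dots> = lcomb {..<M} a b i j"
      by (simp add: b_def lcomb_def sum_distrib_left mult_ac)
    finally show "lcomb (\<Union>m<M. K m) (\<lambda>k. a (idx k) * t (idx k) k) x i j = lcomb {..<M} a b i j" .
  qed
  define A where "A = unc_const * unc_const / \<delta>"
  have A: "0 < A" using unc_const_ge_1 \<delta> by (simp add: A_def)
  have \<beta>: "0 < \<beta>" using b(1) b(2)[of 0] b(3)[of 0] by linarith
  have upper: "N (lcomb {..<M} a b) \<le> A * (C * (unc_const * \<beta>)) * unit_norm g M a" for M a
  proof -
    let ?KK = "\<Union>m<M. K m"
    let ?v = "\<lambda>k. restr (S (idx k)) (x k)"
    have "N (lcomb ?KK (\<lambda>k. a (idx k) * t (idx k) k) x) \<le> A * (C * (unc_const * \<beta>) * unit_norm g M a)"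
      unfolding A_def
    proof (rule N_lcomb_le_if_cf_ge[where v = ?v])
      fix k assume "k \<in> ?KK"
      then show "\<delta> \<le> \<bar>cf (?v k) k\<bar>" using \<delta>(2) idx by (auto simp: S_def)
    next
      fix \<epsilon> :: "nat \<Rightarrow> real" assume \<epsilon>: "signs \<epsilon>"
      have "lcomb ?KK (\<lambda>k. \<epsilon> k * (a (idx k) * t (idx k) k)) ?v = lcomb {..<M} a (\<lambda>m. restr (S m) (y \<epsilon> m))"
      proof (intro ext)
        fix i j
        have "lcomb ?KK (\<lambda>k. \<epsilon> k * (a (idx k) * t (idx k) k)) ?v i j
            = (\<Sum>m<M. \<Sum>k\<in>K m. \<epsilon> k * (a m * t m k) * restr (S m) (x k) i j)"
          unfolding lcomb_def by (rule sum_UN_index[OF K idx])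
        also have "\<dots> = (\<Sum>m<M. a m * restr (S m) (y \<epsilon> m) i j)"
          by (intro sum.cong refl) (simp add: restr_def y_def lcomb_def sum_distrib_left mult_ac)
        finally show "lcomb ?KK (\<lambda>k. \<epsilon> k * (a (idx k) * t (idx k) k)) ?v i j
            = lcomb {..<M} a (\<lambda>m. restr (S m) (y \<epsilon> m)) i j"
          by (simp add: lcomb_def)
      qed
      moreover have "N (lcomb {..<M} a (\<lambda>m. restr (S m) (y \<epsilon> m)))
          \<le> C * unit_norm g M (\<lambda>m. a m * N (restr (S m) (y \<epsilon> m)))"
        by (rule level_estimate_upper[OF est J]) (simp_all add: restrS restr_mem yX)
      moreover have "unit_norm g M (\<lambda>m. a m * N (restr (S m) (y \<epsilon> m))) \<le> unit_norm g M (\<lambda>m. (unc_const * \<beta>) * a m)"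
      proof (rule unit_norm_mono[OF ge])
        fix m
        have "N (restr (S m) (y \<epsilon> m)) \<le> unc_const * N (b m)"
          using N_restr_le[OF yX] Ny[OF \<epsilon>] by (rule order_trans)
        also have "\<dots> \<le> unc_const * \<beta>" using unc_const_ge_1 b(3) by (intro mult_left_mono) (auto simp: b_def)
        finally have "\<bar>a m\<bar> * N (restr (S m) (y \<epsilon> m)) \<le> \<bar>a m\<bar> * (unc_const * \<beta>)"
          by (intro mult_left_mono) auto
        then show "\<bar>a m * N (restr (S m) (y \<epsilon> m))\<bar> \<le> \<bar>(unc_const * \<beta>) * a m\<bar>"
          using unc_const_ge_1 \<beta> N_nonneg[OF restr_mem[OF yX]] by (simp add: abs_mult mult_ac)
      qed
      moreover have "unit_norm g M (\<lambda>m. (unc_const * \<beta>) * a m) = (unc_const * \<beta>) * unit_norm g M a"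
        using unc_const_ge_1 \<beta> by (simp add: unit_norm_scale[OF ge])
      ultimately show "N (lcomb ?KK (\<lambda>k. \<epsilon> k * (a (idx k) * t (idx k) k)) ?v) \<le> C * (unc_const * \<beta>) * unit_norm g M a"
        using C by (simp add: mult.assoc) (meson mult_left_mono less_imp_le order_trans)
    qed (use K \<delta> restr_mem in auto)
    moreover note flat
    ultimately show ?thesis by (simp add: mult_ac)
  qed
  define \<kappa> where "\<kappa> = \<alpha> / (2 * A)"
  have \<kappa>: "0 < \<kappa>" using A b(1) by (simp add: \<kappa>_def)
  \<comment> \<open>The part of a block on its own levels may vanish by cancellation although each
    \<open>x k\<close> is detected there. If it were small for every choice of signs,
    \<open>N_lcomb_le_if_cf_ge\<close> would bound the block by
    \<open>A * \<kappa> = \<alpha> / 2\<close>.\<close>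
  have "\<exists>\<epsilon>. signs \<epsilon> \<and> \<kappa> \<le> N (restr (S m) (y \<epsilon> m))" for m
  proof (rule ccontr)
    assume "\<not> ?thesis"
    then have less: "N (restr (S m) (y \<epsilon> m)) \<le> \<kappa>" if "signs \<epsilon>" for \<epsilon>
      using that by (meson less_imp_le not_le)
    have "N (lcomb (K m) (t m) x) \<le> A * \<kappa>"
      unfolding A_def
    proof (rule N_lcomb_le_if_cf_ge[where v = "\<lambda>k. restr (S m) (x k)"])
      fix \<epsilon> :: "nat \<Rightarrow> real" assume \<epsilon>: "signs \<epsilon>"
      have "lcomb (K m) (\<lambda>k. \<epsilon> k * t m k) (\<lambda>k. restr (S m) (x k)) = restr (S m) (y \<epsilon> m)"
        by (auto simp: fun_eq_iff lcomb_def restr_def y_def)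
      then show "N (lcomb (K m) (\<lambda>k. \<epsilon> k * t m k) (\<lambda>k. restr (S m) (x k))) \<le> \<kappa>"
        using less[OF \<epsilon>] by simp
    qed (use K \<delta> restr_mem in \<open>auto simp: S_def\<close>)
    then have "\<alpha> \<le> \<alpha> / 2" using b(2)[of m] A by (simp add: \<kappa>_def)
    then show False using b(1) by simp
  qed
  then obtain E where E: "\<And>m. signs (E m)" "\<And>m. \<kappa> \<le> N (restr (S m) (y (E m) m))" by metis
  have lower: "c * \<kappa> / unc_const * unit_norm g M a \<le> N (lcomb {..<M} a b)" for M a
  proof -
    let ?KK = "\<Union>m<M. K m"
    let ?y = "\<lambda>m. y (E m) m"
    have "unit_norm g M (\<lambda>m. \<kappa> * a m) \<le> unit_norm g M (\<lambda>m. a m * N (restr (S m) (?y m)))"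
    proof (rule unit_norm_mono[OF ge])
      fix m
      have "\<bar>a m\<bar> * \<kappa> \<le> \<bar>a m\<bar> * N (restr (S m) (?y m))" using E(2) by (intro mult_left_mono) auto
      then show "\<bar>\<kappa> * a m\<bar> \<le> \<bar>a m * N (restr (S m) (?y m))\<bar>"
        using \<kappa> N_nonneg[OF restr_mem[OF yX]] by (simp add: abs_mult mult_ac)
    qed
    then have "c * (\<kappa> * unit_norm g M a) \<le> c * unit_norm g M (\<lambda>m. a m * N (restr (S m) (?y m)))"
      using c \<kappa> by (simp add: unit_norm_scale[OF ge])
    also have "\<dots> \<le> N (lcomb {..<M} a (\<lambda>m. restr (S m) (?y m)))"
      by (rule level_estimate_lower[OF est J]) (simp_all add: restrS restr_mem yX)
    also have "\<dots> \<le> unc_const * N (lcomb {..<M} a b)"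
    proof -
      have "N (\<lambda>i j. \<Sum>m<M. restr (S m) (\<lambda>i j. a m * ?y m i j) i j) \<le> unc_const * N (lcomb {..<M} a b)"
      proof (rule N_restr_diagonal)
        fix \<epsilon> :: "nat \<Rightarrow> real" assume \<epsilon>: "signs \<epsilon>"
        \<comment> \<open>The signs \<open>\<epsilon>\<close> of the diagonal argument and the signs
          \<open>E\<close> chosen inside the blocks are absorbed together by a single use of
          unconditionality.\<close>
        let ?e = "\<lambda>k. \<epsilon> (idx k) * E (idx k) k"
        have "signs ?e"
          unfolding signs_def
        proof
          fix k show "?e k = 1 \<or> ?e k = -1"
            using \<epsilon>[unfolded signs_def, rule_format, of "idx k"]
              E(1)[of "idx k", unfolded signs_def, rule_format, of k] by auto
        qed
        then have "N (lcomb ?KK (\<lambda>k. ?e k * (a (idx k) * t (idx k) k)) x)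
            \<le> unc_const * N (lcomb ?KK (\<lambda>k. a (idx k) * t (idx k) k) x)"
          using K by (intro N_signed_lcomb_le) auto
        moreover have "lcomb ?KK (\<lambda>k. ?e k * (a (idx k) * t (idx k) k)) x
            = lcomb {..<M} \<epsilon> (\<lambda>m i j. a m * ?y m i j)"
        proof (intro ext)
          fix i j
          have "lcomb ?KK (\<lambda>k. ?e k * (a (idx k) * t (idx k) k)) x i j
              = (\<Sum>m<M. \<Sum>k\<in>K m. (\<epsilon> m * E m k * (a m * t m k)) * x k i j)"
            unfolding lcomb_def by (rule sum_UN_index[OF K idx])
          also have "\<dots> = lcomb {..<M} \<epsilon> (\<lambda>m i j. a m * ?y m i j) i j"
            by (simp add: y_def lcomb_def sum_distrib_left mult_ac)
          finally show "lcomb ?KK (\<lambda>k. ?e k * (a (idx k) * t (idx k) k)) x i j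
              = lcomb {..<M} \<epsilon> (\<lambda>m i j. a m * ?y m i j) i j" .
        qed
        moreover note flat
        ultimately show "N (lcomb {..<M} \<epsilon> (\<lambda>m i j. a m * ?y m i j)) \<le> unc_const * N (lcomb {..<M} a b)" by simp
      qed (use yX scale_mem Sdisj in \<open>auto simp: disjoint_family_on_def\<close>)
      moreover have "(\<lambda>i j. \<Sum>m<M. restr (S m) (\<lambda>i j. a m * ?y m i j) i j) = lcomb {..<M} a (\<lambda>m. restr (S m) (?y m))"
        by (intro ext) (auto simp: lcomb_def restr_def intro!: sum.cong)
      ultimately show ?thesis by simp
    qed
    finally show ?thesis using unc_const_ge_1 by (simp add: field_simps)
  qed
  have "0 < c * \<kappa> / unc_const" using c \<kappa> unc_const_ge_1 by simp
  moreover have "N (lcomb {..<M} a b) \<le> max (c * \<kappa> / unc_const) (A * (C * (unc_const * \<beta>))) * unit_norm g M a" for M a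
    using upper[of M a] unit_norm_nonneg[OF ge, of M a]
    by (meson max.cobounded2 mult_right_mono order_trans)
  ultimately show ?thesis
    unfolding equiv_unit_basis_def b_def[symmetric] using lower
    by (intro exI[of _ "c * \<kappa> / unc_const"] exI[of _ "max (c * \<kappa> / unc_const) (A * (C * (unc_const * \<beta>)))"]) auto
qed

section \<open>Gliding humps along the levels\<close>

lemma cf_tail_tendsto:
  assumes "level_system g R lev" "y \<in> X"
  shows "(\<lambda>L. cf (restr (levset R lev {L..}) y) k) \<longlonglongrightarrow> 0"
proof (rule Lim_null_comparison)
  show "(\<lambda>L. unc_const * N (restr (levset R lev {L..}) y)) \<longlonglongrightarrow> 0"
    using tendsto_mult_left[OF level_system_tail[OF assms], of unc_const] by simp
  show "\<forall>\<^sub>F L in sequentially. norm (cf (restr (levset R lev {L..}) y) k) \<le> unc_const * N (restr (levset R lev {L..}) y)"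
    using abs_cf_le[OF restr_mem[OF assms(2)]] by simp
qed

lemma cf_restr_Un:
  assumes "y \<in> X" "S \<inter> T = {}"
  shows "cf (restr (S \<union> T) y) k = cf (restr S y) k + cf (restr T y) k"
proof -
  have "restr (S \<union> T) y = (\<lambda>i j. restr S y i j + restr T y i j)"
    using assms(2) by (auto simp: restr_def fun_eq_iff)
  then show ?thesis using cf_add restr_mem assms(1) by simp
qed

lemma cf_levset_atLeast:
  assumes "y \<in> X" "L \<le> L'"
  shows "cf (restr (levset R lev {L..}) y) k
    = cf (restr (levset R lev {L..<L'}) y) k + cf (restr (levset R lev {L'..}) y) k"
proof -
  have "levset R lev {L..} = levset R lev {L..<L'} \<union> levset R lev {L'..}"
    using assms(2) by (auto simp: levset_def)
  moreover have "levset R lev {L..<L'} \<inter> levset R lev {L'..} = {}" by (auto simp: levset_def)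
  ultimately show ?thesis using cf_restr_Un[OF assms(1)] by metis
qed

lemma cf_levset_lessThan:
  assumes "y \<in> X"
  shows "cf (restr R y) k = cf (restr (levset R lev {..<L}) y) k + cf (restr (levset R lev {L..}) y) k"
proof -
  have "R = levset R lev {..<L} \<union> levset R lev {L..}"
    by (auto simp: levset_def)
  moreover have "levset R lev {..<L} \<inter> levset R lev {L..} = {}" by (auto simp: levset_def)
  ultimately show ?thesis using cf_restr_Un[OF assms(1)] by metis
qed

text \<open>Above every level \<open>L\<close> infinitely many \<open>x k\<close> are detected. Half
  of the detected amount survives truncation at some finite \<open>L'\<close>, where the search for
  the next vector starts. The blocks are singletons.\<close>

theorem subseq_equiv_unit_basis_if_levels:
  assumes g: "level_system g R lev" and \<delta>: "0 < \<delta>"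
    and hyp: "\<And>L k0. \<exists>k\<ge>k0. \<delta> \<le> \<bar>cf (restr (levset R lev {L..}) (x k)) k\<bar>"
  shows "subseq_equiv_unit_basis N x g"
proof -
  let ?P = "\<lambda>(k, L, L'). L \<le> L' \<and> \<delta> / 2 \<le> \<bar>cf (restr (levset R lev {L..<L'}) (x k)) k\<bar>"
  have step: "\<exists>k L'. k0 \<le> k \<and> ?P (k, L, L')" for k0 L
  proof -
    obtain k where k: "k0 \<le> k" "\<delta> \<le> \<bar>cf (restr (levset R lev {L..}) (x k)) k\<bar>"
      using hyp by blast
    have "\<forall>\<^sub>F L' in sequentially. \<bar>cf (restr (levset R lev {L'..}) (x k)) k\<bar> < \<delta> / 2"
      using tendstoD[OF cf_tail_tendsto[OF g x_mem], of "\<delta> / 2" k] \<delta> by simp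
    with eventually_ge_at_top[of L]
    have "\<forall>\<^sub>F L' in sequentially. L \<le> L' \<and> \<bar>cf (restr (levset R lev {L'..}) (x k)) k\<bar> < \<delta> / 2"
      by eventually_elim auto
    then obtain L' where L': "L \<le> L'" "\<bar>cf (restr (levset R lev {L'..}) (x k)) k\<bar> < \<delta> / 2"
      using eventually_happens'[OF sequentially_bot] by blast
    have "?P (k, L, L')"
      using k L' cf_levset_atLeast[OF x_mem L'(1), of R lev k k] by auto
    then show ?thesis using k by blast
  qed
  have "\<exists>f. \<forall>m. ?P (f m) \<and> (\<lambda>(k, L, L') (k2, L2, L2'). k < k2 \<and> L' \<le> L2) (f m) (f (Suc m))"
  proof (rule dependent_nat_choice)
    show "\<exists>s. ?P s" using step[of 0 0] by blast
    fix s and m :: nat assume "?P s"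
    obtain k L L' where s: "s = (k, L, L')" by (cases s) auto
    show "\<exists>s'. ?P s' \<and> (\<lambda>(k, L, L') (k2, L2, L2'). k < k2 \<and> L' \<le> L2) s s'"
      using step[of "Suc k" L'] unfolding s by (fastforce simp: Suc_le_eq)
  qed
  then obtain f where f: "\<forall>m. ?P (f m) \<and> (\<lambda>(k, L, L') (k2, L2, L2'). k < k2 \<and> L' \<le> L2) (f m) (f (Suc m))" ..
  define \<phi> where "\<phi> m = fst (f m)" for m
  define lo where "lo m = fst (snd (f m))" for m
  define hi where "hi m = snd (snd (f m))" for m
  have \<phi>: "\<And>m. \<phi> m < \<phi> (Suc m)" and lohi: "\<And>m. lo m \<le> hi m" "\<And>m. hi m \<le> lo (Suc m)"
    and big: "\<And>m. \<delta> / 2 \<le> \<bar>cf (restr (levset R lev {lo m..<hi m}) (x (\<phi> m))) (\<phi> m)\<bar>"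
    using f by (auto simp: \<phi>_def lo_def hi_def split_beta)
  have mono: "strict_mono \<phi>" using \<phi> by (simp add: strict_mono_Suc_iff)
  have single: "lcomb {\<phi> m} (\<lambda>k. 1) x = x (\<phi> m)" for m
    by (simp add: lcomb_def)
  have "equiv_unit_basis N (\<lambda>m. lcomb {\<phi> m} (\<lambda>k. 1) x) g"
  proof (rule equiv_unit_basis_blocks[OF g disjoint_family_intervals[of lo hi, OF lohi], where \<delta> = "\<delta> / 2" and \<alpha> = 1 and \<beta> = 1])
    show "disjoint_family (\<lambda>m. {\<phi> m})"
      using strict_mono_eq[OF mono] by (auto simp: disjoint_family_on_def)
  qed (use big \<delta> single in auto)
  then show ?thesis
    unfolding subseq_equiv_unit_basis_def using mono by (auto simp: single comp_def)
qed

section \<open>Comparison of two level systems\<close>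

text \<open>A subsequence of \<open>w\<close> is close to blocks of the basis. The blocks escape
  through the levels of the first system and behave like \<open>g\<close>, while \<open>w\<close>
  sits on disjoint levels of the second and behaves like \<open>g'\<close>. The blocks use whole
  intervals of basis indices, so detection by \<open>R\<close> is assumed for all large
  \<open>k\<close>.\<close>

lemma level_exponents_eq_aux:
  assumes g: "level_system g R lev" and g': "level_system g' R' lev'"
    and null: "\<And>L. (\<lambda>k. cf (restr (levset R lev {..<L}) (x k)) k) \<longlonglongrightarrow> 0"
    and \<delta>: "0 < \<delta>" "\<And>k. k0 \<le> k \<Longrightarrow> \<delta> \<le> \<bar>cf (restr R (x k)) k\<bar>"
    and w: "\<And>m. w m \<in> X" "\<And>k. (\<lambda>m. cf (w m) k) \<longlonglongrightarrow> 0"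
      "\<And>m. 1 \<le> N (w m)" "\<And>m. N (w m) \<le> 2"
    and J': "disjoint_family J'" "\<And>m. restr (levset R' lev' (J' m)) (w m) = w m"
  shows "g = g'"
proof -
  let ?P = "\<lambda>s (m, kl, kh, L, L'). kl \<le> kh \<and> L \<le> L' \<and>
    (\<forall>k\<in>{kl..<kh}. \<delta> / 2 \<le> \<bar>cf (restr (levset R lev {L..<L'}) (x k)) k\<bar>) \<and>
    N (w m - lcomb {kl..<kh} (cf (w m)) x) \<le> (1/2) ^ Suc s"
  let ?Q = "\<lambda>(m, kl, kh, L, L') (m2, kl2, kh2, L2, L2'). m < m2 \<and> kh \<le> kl2 \<and> L' \<le> L2"
  \<comment> \<open>Order of the choices: given \<open>L\<close>, first \<open>kl\<close>, beyond
    which the levels below \<open>L\<close> detect little; then \<open>m\<close>, making the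
    coefficients of \<open>w m\<close> below \<open>kl\<close> small; then \<open>kh\<close> from
    the expansion of \<open>w m\<close>; last \<open>L'\<close>, beyond which none of the finitely
    many \<open>x k\<close> in the block is detected much.\<close>
  have step: "\<exists>m kl kh L'. m0 \<le> m \<and> k1 \<le> kl \<and> ?P s (m, kl, kh, L, L')" for s m0 k1 L :: nat
  proof -
    \<comment> \<open>Half of the permitted error is for the coefficients below \<open>kl\<close>,
      half for those from \<open>kh\<close> on.\<close>
    define \<epsilon> :: real where "\<epsilon> = (1/2) ^ Suc s / 2"
    have \<epsilon>: "0 < \<epsilon>" by (simp add: \<epsilon>_def)
    obtain k2 where k2: "\<And>k. k2 \<le> k \<Longrightarrow> \<bar>cf (restr (levset R lev {..<L}) (x k)) k\<bar> < \<delta> / 4"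
      using LIMSEQ_D[OF null[of L], of "\<delta> / 4"] \<delta>(1) by auto
    define kl where "kl = max k1 (max k0 k2)"
    have "(\<lambda>m. \<Sum>k<kl. \<bar>cf (w m) k\<bar>) \<longlonglongrightarrow> 0"
      using w(2) by (intro tendsto_null_sum) (simp add: tendsto_rabs_zero_iff)
    then obtain m1 where m1: "\<And>m. m1 \<le> m \<Longrightarrow> (\<Sum>k<kl. \<bar>cf (w m) k\<bar>) < \<epsilon>"
      using LIMSEQ_D[of _ 0 \<epsilon>] \<epsilon> by fastforce
    define m where "m = max m0 m1"
    obtain n1 where n1: "\<And>n. n1 \<le> n \<Longrightarrow> N (w m - lcomb {..<n} (cf (w m)) x) < \<epsilon>"
      using LIMSEQ_D[OF expands_cf[OF w(1)[of m], unfolded expands_def] \<epsilon>] by fastforce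
    define kh where "kh = max kl n1"
    have "{..<kh} = {..<kl} \<union> {kl..<kh}" by (auto simp: kh_def)
    then have "lcomb {..<kh} (cf (w m)) x i j = lcomb {..<kl} (cf (w m)) x i j + lcomb {kl..<kh} (cf (w m)) x i j" for i j
      by (simp add: lcomb_def ivl_disj_int sum.union_disjoint)
    then have "w m - lcomb {kl..<kh} (cf (w m)) x
        = (\<lambda>i j. (w m - lcomb {..<kh} (cf (w m)) x) i j + lcomb {..<kl} (cf (w m)) x i j)"
      by (simp add: fun_eq_iff)
    then have "N (w m - lcomb {kl..<kh} (cf (w m)) x)
        \<le> N (w m - lcomb {..<kh} (cf (w m)) x) + N (lcomb {..<kl} (cf (w m)) x)"
      using N_add[OF minus_mem[OF w(1) lcomb_x_mem] lcomb_x_mem] by metis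
    also have "\<dots> \<le> \<epsilon> + \<epsilon>"
    proof (rule add_mono)
      show "N (w m - lcomb {..<kh} (cf (w m)) x) \<le> \<epsilon>" using n1[of kh] by (simp add: kh_def)
      have "N (lcomb {..<kl} (cf (w m)) x) \<le> (\<Sum>k<kl. \<bar>cf (w m) k\<bar> * N (x k))"
        by (rule N_lcomb) simp
      also have "\<dots> \<le> \<epsilon>" using m1[of m] by (simp add: m_def)
      finally show "N (lcomb {..<kl} (cf (w m)) x) \<le> \<epsilon>" .
    qed
    finally have approx: "N (w m - lcomb {kl..<kh} (cf (w m)) x) \<le> (1/2) ^ Suc s"
      by (simp add: \<epsilon>_def)
    have "\<forall>\<^sub>F L' in sequentially. \<forall>k\<in>{kl..<kh}. \<bar>cf (restr (levset R lev {L'..}) (x k)) k\<bar> < \<delta> / 4"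
    proof (intro eventually_ball_finite ballI)
      fix k
      show "\<forall>\<^sub>F L' in sequentially. \<bar>cf (restr (levset R lev {L'..}) (x k)) k\<bar> < \<delta> / 4"
        using tendstoD[OF cf_tail_tendsto[OF g x_mem], of "\<delta> / 4" k] \<delta>(1) by simp
    qed simp
    with eventually_ge_at_top[of L]
    have "\<forall>\<^sub>F L' in sequentially. L \<le> L' \<and> (\<forall>k\<in>{kl..<kh}. \<bar>cf (restr (levset R lev {L'..}) (x k)) k\<bar> < \<delta> / 4)"
      by eventually_elim auto
    then obtain L' where L': "L \<le> L'" "\<And>k. k \<in> {kl..<kh} \<Longrightarrow> \<bar>cf (restr (levset R lev {L'..}) (x k)) k\<bar> < \<delta> / 4"
      using eventually_happens'[OF sequentially_bot] by blast
    \<comment> \<open>Of the amount \<open>\<delta>\<close>, at most a quarter is lost below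
      \<open>L\<close> and a quarter from \<open>L'\<close> on.\<close>
    have "\<delta> / 2 \<le> \<bar>cf (restr (levset R lev {L..<L'}) (x k)) k\<bar>" if "k \<in> {kl..<kh}" for k
    proof -
      have "k0 \<le> k" "k2 \<le> k" using that by (auto simp: kl_def)
      then show ?thesis
        using \<delta>(2)[of k] k2[of k] L'(2)[OF that] cf_levset_lessThan[OF x_mem, of R k k lev L]
          cf_levset_atLeast[OF x_mem L'(1), of R lev k k] by linarith
    qed
    then have "?P s (m, kl, kh, L, L')" using approx L'(1) by (simp add: kh_def)
    moreover have "m0 \<le> m" "k1 \<le> kl" by (auto simp: m_def kl_def)
    ultimately show ?thesis by blast
  qed
  have "\<exists>f. \<forall>s. ?P s (f s) \<and> ?Q (f s) (f (Suc s))"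
  proof (rule dependent_nat_choice)
    show "\<exists>s. ?P 0 s" using step[of 0 0 0 0] by blast
    fix z and s :: nat assume "?P s z"
    obtain m kl kh L L' where z: "z = (m, kl, kh, L, L')" by (cases z) auto
    obtain m2 kl2 kh2 L2' where "Suc m \<le> m2" "kh \<le> kl2" "?P (Suc s) (m2, kl2, kh2, L', L2')"
      using step[of "Suc m" kh "Suc s" L'] by blast
    then have "?P (Suc s) (m2, kl2, kh2, L', L2') \<and> ?Q z (m2, kl2, kh2, L', L2')"
      by (simp add: z)
    then show "\<exists>z'. ?P (Suc s) z' \<and> ?Q z z'" by blast
  qed
  then obtain f where f: "\<forall>s. ?P s (f s) \<and> ?Q (f s) (f (Suc s))" ..
  define \<mu> where "\<mu> s = fst (f s)" for s
  define kl where "kl s = fst (snd (f s))" for s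
  define kh where "kh s = fst (snd (snd (f s)))" for s
  define lo where "lo s = fst (snd (snd (snd (f s))))" for s
  define hi where "hi s = snd (snd (snd (snd (f s))))" for s
  have ord: "\<And>s. \<mu> s < \<mu> (Suc s)" "\<And>s. kl s \<le> kh s" "\<And>s. kh s \<le> kl (Suc s)"
      "\<And>s. lo s \<le> hi s" "\<And>s. hi s \<le> lo (Suc s)"
    and big: "\<And>s k. k \<in> {kl s..<kh s} \<Longrightarrow> \<delta> / 2 \<le> \<bar>cf (restr (levset R lev {lo s..<hi s}) (x k)) k\<bar>"
    and approx: "\<And>s. N (w (\<mu> s) - lcomb {kl s..<kh s} (cf (w (\<mu> s))) x) \<le> (1/2) ^ Suc s"
    using f by (auto simp: \<mu>_def kl_def kh_def lo_def hi_def split_beta)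
  have mono: "strict_mono \<mu>" using ord(1) by (simp add: strict_mono_Suc_iff)
  define b where "b s = lcomb {kl s..<kh s} (cf (w (\<mu> s))) x" for s
  have bX: "b s \<in> X" for s by (simp add: b_def)
  have diff: "N (w (\<mu> s) - b s) \<le> 1/2" for s
  proof -
    have "(1/2 :: real) ^ Suc s \<le> 1/2" by (simp add: power_le_one)
    then show ?thesis using approx[of s] by (simp add: b_def)
  qed
  have diff_sym: "N (b s - w (\<mu> s)) = N (w (\<mu> s) - b s)" for s
    using N_scale[OF minus_mem[OF w(1) bX], of "-1"] by (simp add: fun_diff_def)
  \<comment> \<open>A block differs by at most 1/2 from a vector whose norm lies between 1 and 2,
    which explains the bounds 1/2 and 3.\<close>
  have "equiv_unit_basis N b g"
    unfolding b_def
  proof (rule equiv_unit_basis_blocks[OF g disjoint_family_intervals[of lo hi, OF ord(4,5)], where \<delta> = "\<delta> / 2" and \<alpha> = "1/2" and \<beta> = 3])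
    show "disjoint_family (\<lambda>m. {kl m..<kh m})"
      using disjoint_family_intervals[of kl kh, OF ord(2,3)] .
    fix s
    show "1/2 \<le> N (lcomb {kl s..<kh s} (cf (w (\<mu> s))) x)"
      using N_triangle[OF w(1) bX, of "\<mu> s" s] diff[of s] w(3)[of "\<mu> s"] by (simp add: b_def)
    show "N (lcomb {kl s..<kh s} (cf (w (\<mu> s))) x) \<le> 3"
      using N_triangle[OF bX w(1), of s "\<mu> s"] diff[of s] w(4)[of "\<mu> s"] diff_sym[of s]
      by (simp add: b_def)
  qed (use big \<delta> in auto)
  then obtain c1 C1 where eq1: "0 < c1" "c1 \<le> C1"
    "\<And>n a. c1 * unit_norm g n a \<le> N (lcomb {..<n} a b)"
    "\<And>n a. N (lcomb {..<n} a b) \<le> C1 * unit_norm g n a"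
    unfolding equiv_unit_basis_def by blast
  obtain c2 C2 where eq2: "0 < c2" "0 < C2" "level_estimate g' R' lev' c2 C2"
    using g' unfolding level_system_def by blast
  have ge: "banach_exponent g" "banach_exponent g'"
    using g g' by (simp_all add: level_system_exponent)
  let ?U = "\<lambda>g n. unit_norm g n (\<lambda>i. 1)"
  let ?w = "\<lambda>n. lcomb {..<n} (\<lambda>i. 1) (\<lambda>m. w (\<mu> m))"
  let ?b = "\<lambda>n. lcomb {..<n} (\<lambda>i. 1) b"
  have J'\<mu>: "disjoint_family (\<lambda>m. J' (\<mu> m))"
    using J'(1) strict_mono_eq[OF mono] by (auto simp: disjoint_family_on_def)
  have wlow: "c2 * ?U g' n \<le> N (?w n)" for n
  proof -
    have "?U g' n \<le> unit_norm g' n (\<lambda>m. 1 * N (w (\<mu> m)))"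
      using w(3) by (intro unit_norm_mono ge) (auto intro: order_trans[OF _ abs_ge_self])
    then have "c2 * ?U g' n \<le> c2 * unit_norm g' n (\<lambda>m. 1 * N (w (\<mu> m)))"
      using eq2 by (intro mult_left_mono) auto
    also have "\<dots> \<le> N (?w n)"
      by (rule level_estimate_lower[OF eq2(3) J'\<mu>]) (use w(1) J'(2) in auto)
    finally show ?thesis .
  qed
  have wup: "N (?w n) \<le> C2 * (2 * ?U g' n)" for n
  proof -
    have "N (?w n) \<le> C2 * unit_norm g' n (\<lambda>m. 1 * N (w (\<mu> m)))"
      by (rule level_estimate_upper[OF eq2(3) J'\<mu>]) (use w(1) J'(2) in auto)
    also have "unit_norm g' n (\<lambda>m. 1 * N (w (\<mu> m))) \<le> unit_norm g' n (\<lambda>m. 2 * 1)"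
      using w N_nonneg[OF w(1)] by (intro unit_norm_mono ge) auto
    also have "\<dots> = 2 * ?U g' n"
      using unit_norm_scale[OF ge(2), of n 2 "\<lambda>i. 1"] by simp
    finally show ?thesis using eq2 by simp
  qed
  \<comment> \<open>The errors form a geometric series, so sums of any length differ by at most 1.
    Since \<open>?U\<close> is at least 1 for positive n, this additive 1 is absorbed into the
    constants below.\<close>
  have near: "N (?w n - ?b n) \<le> 1" for n
  proof -
    have "?w n - ?b n = (\<lambda>i j. \<Sum>s<n. (w (\<mu> s) - b s) i j)"
      by (simp add: fun_eq_iff lcomb_def sum_subtractf)
    then have "N (?w n - ?b n) \<le> (\<Sum>s<n. N (w (\<mu> s) - b s))"
      using N_sum[of "{..<n}" "\<lambda>s. w (\<mu> s) - b s"] minus_mem[OF w(1) bX] by metis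
    also have "\<dots> \<le> (\<Sum>s<n. (1/2) ^ Suc s)"
      using approx by (intro sum_mono) (simp add: b_def)
    also have "\<dots> = 1 - (1/2) ^ n" by (induction n) (auto simp: field_simps)
    finally show ?thesis by (smt (verit) zero_le_power divide_nonneg_nonneg)
  qed
  have wX: "?w n \<in> X" "?b n \<in> X" for n by (auto intro: lcomb_mem w(1) bX)
  have near_sym: "N (?b n - ?w n) = N (?w n - ?b n)" for n
    using N_scale[OF minus_mem[OF wX], of "-1"] by (simp add: fun_diff_def)
  show ?thesis
  proof (rule exponent_eq_if_unit_norm_ones_equivalent[OF ge])
    fix n :: nat assume n: "0 < n"
    note one = unit_norm_ones_ge_1[OF ge(1) n] unit_norm_ones_ge_1[OF ge(2) n]
    have "c1 * ?U g n \<le> C2 * (2 * ?U g' n) + 1"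
      using eq1(3)[of n "\<lambda>i. 1"] N_triangle[OF wX(2,1), of n n] near[of n] near_sym[of n] wup[of n] by linarith
    then have "c1 * ?U g n \<le> (2 * C2 + 1) * ?U g' n" using one(2) by (simp add: algebra_simps)
    then show "?U g n \<le> ((2 * C2 + 1) / c1) * ?U g' n" using eq1(1) by (simp add: field_simps)
    have "c2 * ?U g' n \<le> C1 * ?U g n + 1"
      using eq1(4)[of n "\<lambda>i. 1"] N_triangle[OF wX(1,2), of n n] near[of n] wlow[of n] by linarith
    then have "c2 * ?U g' n \<le> (C1 + 1) * ?U g n" using one(1) by (simp add: algebra_simps)
    then show "?U g' n \<le> ((C1 + 1) / c2) * ?U g n" using eq2(1) by (simp add: field_simps)
  qed
qed

text \<open>The coefficients of \<open>E m\<close> need not tend to 0, so \<open>E\<close> itself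
  cannot serve as \<open>w\<close>. Along a subsequence each of them converges; differences of
  neighbouring terms then have null coefficients, while disjoint supports and solidity keep the
  norms at least 1.\<close>

theorem level_exponents_eq:
  assumes g: "level_system g R lev" and g': "level_system g' R' lev'"
    and null: "\<And>L. (\<lambda>k. cf (restr (levset R lev {..<L}) (x k)) k) \<longlonglongrightarrow> 0"
    and \<delta>: "0 < \<delta>" "\<And>k. K \<le> k \<Longrightarrow> \<delta> \<le> \<bar>cf (restr R (x k)) k\<bar>"
    and E: "\<And>m. E m \<in> X" "\<And>m. N (E m) = 1" "\<And>m. restr (levset R' lev' {m}) (E m) = E m"
  shows "g = g'"
proof -
  \<comment> \<open>Diagonal extraction over the countably many coefficients, all bounded by
    \<open>unc_const\<close>.\<close>
  obtain r :: "nat \<Rightarrow> nat" where r: "strict_mono r" and conv: "\<And>k. \<exists>l. (\<lambda>n. cf (E (r n)) k) \<longlonglongrightarrow> l"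
  proof (rule function_convergent_subsequence[of "UNIV :: nat set" "\<lambda>n k. cf (E n) k" unc_const])
    show "norm (cf (E n) k) \<le> unc_const" for n k
      using abs_cf_le[OF E(1), of n k] E(2) by simp
  qed auto
  define w where "w m = (\<lambda>i j. E (r (2 * m)) i j - E (r (2 * m + 1)) i j)" for m
  define J' where "J' m = {r (2 * m), r (2 * m + 1)}" for m
  have neq: "r (2 * m) \<noteq> r (2 * m + 1)" for m
    using strict_mono_eq[OF r] by simp
  have supp: "E m i j = 0" if "(i, j) \<notin> levset R' lev' {m}" for m i j
    using E(3)[of m] that by (metis restr_def)
  show ?thesis
  proof (rule level_exponents_eq_aux[OF g g' null \<delta>, of K w J'])
    show wX: "w m \<in> X" for m unfolding w_def by (intro diff_mem E)
    show "(\<lambda>m. cf (w m) k) \<longlonglongrightarrow> 0" for k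
    proof -
      obtain l where l: "(\<lambda>n. cf (E (r n)) k) \<longlonglongrightarrow> l" using conv by blast
      have "(\<lambda>m. cf (E (r (2 * m))) k - cf (E (r (2 * m + 1))) k) \<longlonglongrightarrow> l - l"
        using LIMSEQ_subseq_LIMSEQ[OF l, of "\<lambda>m. 2 * m"] LIMSEQ_subseq_LIMSEQ[OF l, of "\<lambda>m. 2 * m + 1"]
        by (intro tendsto_diff) (auto simp: strict_mono_def comp_def)
      then show ?thesis by (simp add: w_def cf_diff E)
    qed
    show "1 \<le> N (w m)" for m
    proof -
      have "N (E (r (2 * m))) \<le> N (w m)"
      proof (rule N_solid[OF wX])
        fix i j
        show "\<bar>E (r (2 * m)) i j\<bar> \<le> \<bar>w m i j\<bar>"
          using supp[of i j "r (2 * m)"] supp[of i j "r (2 * m + 1)"] neq[of m]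
          by (cases "(i, j) \<in> levset R' lev' {r (2 * m)}") (auto simp: w_def levset_def)
      qed
      then show ?thesis by (simp add: E)
    qed
    show "N (w m) \<le> 2" for m
      unfolding w_def using N_diff[OF E(1) E(1), of "r (2 * m)" "r (2 * m + 1)"] by (simp add: E)
    show "disjoint_family J'"
      unfolding disjoint_family_on_def J'_def using strict_mono_eq[OF r] by (auto; presburger)
    show "restr (levset R' lev' (J' m)) (w m) = w m" for m
    proof (intro ext)
      fix i j
      show "restr (levset R' lev' (J' m)) (w m) i j = w m i j"
        using supp[of i j "r (2 * m)"] supp[of i j "r (2 * m + 1)"]
        by (auto simp: restr_def w_def J'_def levset_def)
    qed
  qed
qed

section \<open>Detection by finitely many entries\<close>

text \<open>Two consecutive remainders of the expansion differ by one term, and \<open>x n\<close>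
  has norm 1.\<close>

lemma cf_tendsto_0: assumes "y \<in> X" shows "cf y \<longlonglongrightarrow> 0"
proof (rule Lim_null_comparison)
  let ?r = "\<lambda>n. y - lcomb {..<n} (cf y) x"
  have lim: "(\<lambda>n. N (?r n)) \<longlonglongrightarrow> 0"
    using expands_cf[OF assms] by (simp add: expands_def)
  show "(\<lambda>n. N (?r n) + N (?r (Suc n))) \<longlonglongrightarrow> 0"
    using tendsto_add[OF lim LIMSEQ_Suc[OF lim]] by simp
  have "norm (cf y n) \<le> N (?r n) + N (?r (Suc n))" for n
  proof -
    have "(\<lambda>i j. cf y n * x n i j) = (\<lambda>i j. ?r n i j - ?r (Suc n) i j)"
      by (simp add: fun_eq_iff lcomb_def)
    then have "N (\<lambda>i j. cf y n * x n i j) \<le> N (?r n) + N (?r (Suc n))"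
      using N_diff[OF minus_mem[OF assms] minus_mem[OF assms], of "lcomb {..<n} (cf y) x" "lcomb {..<Suc n} (cf y) x"]
      by simp
    then show ?thesis by (simp add: N_scale)
  qed
  then show "\<forall>\<^sub>F n in sequentially. norm (cf y n) \<le> N (?r n) + N (?r (Suc n))" by simp
qed

text \<open>\<open>restr S (x k)\<close> combines a fixed finite set of unit matrices with entries
  of modulus at most 1, and the k-th coefficient of each unit matrix tends to 0. So a bounded
  rectangle detects nothing in the limit.\<close>

lemma cf_restr_finite_tendsto_0:
  assumes "finite S" and E: "\<And>s. (\<lambda>i j. if (i, j) = s then 1 else 0) \<in> X"
  shows "(\<lambda>k. cf (restr S (x k)) k) \<longlonglongrightarrow> 0"
proof (rule Lim_null_comparison)
  let ?E = "\<lambda>s i j. if (i, j) = s then 1 else 0 :: real"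
  show "(\<lambda>k. \<Sum>s\<in>S. \<bar>cf (?E s) k\<bar>) \<longlonglongrightarrow> 0"
    using cf_tendsto_0[OF E] by (intro tendsto_null_sum) (simp add: tendsto_rabs_zero_iff)
  have "norm (cf (restr S (x k)) k) \<le> (\<Sum>s\<in>S. \<bar>cf (?E s) k\<bar>)" for k
  proof -
    have "restr S (x k) = (\<lambda>i j. \<Sum>s\<in>S. x k (fst s) (snd s) * ?E s i j)"
    proof (intro ext)
      fix i j
      have "(\<Sum>s\<in>S. x k (fst s) (snd s) * ?E s i j) = (\<Sum>s\<in>S. if s = (i, j) then x k i j else 0)"
        by (intro sum.cong) auto
      then show "restr S (x k) i j = (\<Sum>s\<in>S. x k (fst s) (snd s) * ?E s i j)"
        using assms(1) by (simp add: restr_def sum.delta)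
    qed
    then have "cf (restr S (x k)) k = (\<Sum>s\<in>S. x k (fst s) (snd s) * cf (?E s) k)"
      using cf_sum[of S "\<lambda>s i j. x k (fst s) (snd s) * ?E s i j" k] E by (simp add: scale_mem cf_scale)
    also have "\<bar>\<dots>\<bar> \<le> (\<Sum>s\<in>S. \<bar>cf (?E s) k\<bar>)"
    proof (rule order_trans[OF sum_abs sum_mono])
      fix s assume "s \<in> S"
      have "\<bar>x k (fst s) (snd s)\<bar> \<le> 1" using abs_entry_le[OF x_mem, of k] by simp
      then show "\<bar>x k (fst s) (snd s) * cf (?E s) k\<bar> \<le> \<bar>cf (?E s) k\<bar>"
        by (simp add: abs_mult mult_left_le_one_le)
    qed
    finally show ?thesis by simp
  qed
  then show "\<forall>\<^sub>F k in sequentially. norm (cf (restr S (x k)) k) \<le> (\<Sum>s\<in>S. \<bar>cf (?E s) k\<bar>)" by simp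
qed

end


section \<open>Mixed sequence spaces\<close>

lemma seqnorm_abs: "seqnorm e (\<lambda>i. \<bar>a i\<bar>) = seqnorm e a"
  by (cases e) simp_all

lemma in_seq_abs: "in_seq e (\<lambda>i. \<bar>a i\<bar>) = in_seq e a"
  by (cases e) (simp_all add: tendsto_rabs_zero_iff)

lemma solid_matrix_norm_mixed_space:
  assumes e: "banach_exponent e" and f: "banach_exponent f"
  shows "solid_matrix_norm (mixed_space e f) (mnorm e f)"
proof
  have zero: "seqnorm e (\<lambda>i. 0) = 0" using seqnorm_zero[OF e] .
  show "(\<lambda>i j. 0) \<in> mixed_space e f"
    using e f by (simp add: mixed_space_def zero in_seq_finite_support)
  fix a :: "nat \<Rightarrow> nat \<Rightarrow> real" assume a: "a \<in> mixed_space e f"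
  have ca: "in_seq e (\<lambda>i. a i j)" and na: "in_seq f (\<lambda>j. seqnorm e (\<lambda>i. a i j))" for j
    using a by (auto simp: mixed_space_def)
  note nna = seqnorm_nonneg[OF ca]
  {
    fix b assume b: "b \<in> mixed_space e f"
    have cb: "in_seq e (\<lambda>i. b i j)" and nb: "in_seq f (\<lambda>j. seqnorm e (\<lambda>i. b i j))" for j
      using b by (auto simp: mixed_space_def)
    have le: "\<bar>seqnorm e (\<lambda>i. a i j + b i j)\<bar> \<le> \<bar>seqnorm e (\<lambda>i. a i j) + seqnorm e (\<lambda>i. b i j)\<bar>" for j
      using seqnorm_add[OF e ca cb, of j j] seqnorm_nonneg[OF in_seq_add[OF e ca cb], of j j] by linarith
    show "(\<lambda>i j. a i j + b i j) \<in> mixed_space e f"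
      using in_seq_add[OF e ca cb] in_seq_mono[OF f in_seq_add[OF f na nb] le]
      by (simp add: mixed_space_def)
    show "mnorm e f (\<lambda>i j. a i j + b i j) \<le> mnorm e f a + mnorm e f b"
      unfolding mnorm_def
      using seqnorm_mono[OF f in_seq_add[OF f na nb] le] seqnorm_add[OF f na nb] by linarith
  }
  show "(\<lambda>i j. c * a i j) \<in> mixed_space e f" for c
    using in_seq_scale[OF e ca] in_seq_scale[OF f na]
    by (simp add: mixed_space_def seqnorm_scale[OF e ca])
  show "mnorm e f (\<lambda>i j. c * a i j) = \<bar>c\<bar> * mnorm e f a" for c
    unfolding mnorm_def by (simp add: seqnorm_scale[OF e ca] seqnorm_scale[OF f na])
  {
    fix b :: "nat \<Rightarrow> nat \<Rightarrow> real" assume b: "\<And>i j. \<bar>b i j\<bar> \<le> \<bar>a i j\<bar>"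
    have cb: "in_seq e (\<lambda>i. b i j)" for j by (rule in_seq_mono[OF e ca b])
    have le: "\<bar>seqnorm e (\<lambda>i. b i j)\<bar> \<le> \<bar>seqnorm e (\<lambda>i. a i j)\<bar>" for j
      using seqnorm_mono[OF e ca b, of j] seqnorm_nonneg[OF cb, of j] by linarith
    show "b \<in> mixed_space e f"
      using cb in_seq_mono[OF f na le] by (simp add: mixed_space_def)
    show "mnorm e f b \<le> mnorm e f a"
      unfolding mnorm_def by (rule seqnorm_mono[OF f na le])
  }
  show "\<bar>a i j\<bar> \<le> mnorm e f a" for i j
    using abs_le_seqnorm[OF e ca, of i j] abs_le_seqnorm[OF f na, of j] unfolding mnorm_def by linarith
qed

locale mixed_sequence_space =
  fixes e f :: exponent
  assumes e: "banach_exponent e" and f: "banach_exponent f"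
begin

sublocale solid_matrix_norm "mixed_space e f" "mnorm e f"
  by (rule solid_matrix_norm_mixed_space[OF e f])

lemma in_seq_col: "a \<in> mixed_space e f \<Longrightarrow> in_seq e (\<lambda>i. a i j)"
  and in_seq_col_norm: "a \<in> mixed_space e f \<Longrightarrow> in_seq f (\<lambda>j. seqnorm e (\<lambda>i. a i j))"
  by (simp_all add: mixed_space_def)

lemma unit_matrix_mem: "(\<lambda>i j. if (i, j) = s then 1 else 0) \<in> mixed_space e f"
  and mnorm_unit_matrix: "mnorm e f (\<lambda>i j. if (i, j) = s then 1 else 0) = 1"
proof -
  obtain k l where s: "s = (k, l)" by (cases s)
  have col: "seqnorm e (\<lambda>i. if (i, j) = s then 1 else 0) = (if j = l then 1 else 0)" for j
    using seqnorm_single[OF e, of k 1] seqnorm_zero[OF e] by (cases "j = l") (simp_all add: s)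
  have "in_seq e (\<lambda>i. if (i, j) = s then 1 else 0)" for j
    by (rule in_seq_finite_support[OF e]) (auto simp: s intro: finite_subset[of _ "{k}"])
  moreover have "in_seq f (\<lambda>j. if j = l then 1 else 0)"
    by (rule in_seq_finite_support[OF f]) auto
  ultimately show "(\<lambda>i j. if (i, j) = s then 1 else 0) \<in> mixed_space e f"
    by (simp add: mixed_space_def col)
  show "mnorm e f (\<lambda>i j. if (i, j) = s then 1 else 0) = 1"
    unfolding mnorm_def col by (simp add: seqnorm_single[OF f])
qed

text \<open>Every column meets at most one of the vectors, so the estimate is an identity with both
  constants equal to 1.\<close>

lemma level_system_columns: "level_system f UNIV snd"
proof -
  have est: "mnorm e f (lcomb {..<M} a v) = unit_norm f M (\<lambda>m. a m * mnorm e f (v m))"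
    if J: "disjoint_family J"
      and v: "\<And>m. v m \<in> mixed_space e f" "\<And>m. restr (levset UNIV snd (J m)) (v m) = v m" for J M a v
  proof -
    define u where "u m j = seqnorm e (\<lambda>i. v m i j)" for m j
    have v0: "v m i j = 0" if "j \<notin> J m" for m i j
    proof -
      have "(i, j) \<notin> levset UNIV snd (J m)" using that by (simp add: levset_def)
      then show ?thesis using v(2)[of m] by (metis restr_def)
    qed
    have u0: "u m j = 0" if "j \<notin> J m" for m j
      using v0[OF that] seqnorm_zero[OF e] by (simp add: u_def)
    have uniq: "m = n" if "j \<in> J m" "j \<in> J n" for m n j
      using J that by (auto simp: disjoint_family_on_def)
    have u_nonneg: "0 \<le> u m j" for m j
      unfolding u_def by (rule seqnorm_nonneg[OF in_seq_col[OF v(1)]])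
    have "seqnorm e (\<lambda>i. lcomb {..<M} a v i j) = \<bar>\<Sum>m<M. a m * u m j\<bar>" for j
    proof (cases "\<exists>m<M. j \<in> J m")
      case True
      then obtain m where m: "m < M" "j \<in> J m" by blast
      then have other: "j \<notin> J n" if "n \<noteq> m" for n using uniq that by blast
      have "lcomb {..<M} a v i j = a m * v m i j" for i
        unfolding lcomb_def by (rule sum_eq_single_term[OF m(1)]) (simp add: v0 other)
      moreover have "(\<Sum>m<M. a m * u m j) = a m * u m j"
        by (rule sum_eq_single_term[OF m(1)]) (simp add: u0 other)
      ultimately show ?thesis
        using seqnorm_scale[OF e in_seq_col[OF v(1)], of "a m" m j] u_nonneg
        by (simp add: u_def abs_mult)
    next
      case False
      then have "lcomb {..<M} a v i j = 0" "(\<Sum>m<M. a m * u m j) = 0" for i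
        by (auto simp: lcomb_def v0 u0 intro!: sum.neutral)
      then show ?thesis using seqnorm_zero[OF e] by simp
    qed
    then have "mnorm e f (lcomb {..<M} a v) = seqnorm f (\<lambda>j. \<Sum>m<M. a m * u m j)"
      by (simp add: mnorm_def seqnorm_abs)
    also have "\<dots> = unit_norm f M (\<lambda>m. a m * seqnorm f (u m))"
    proof (rule seqnorm_disjoint_sum[OF f])
      show "in_seq f (u m)" for m unfolding u_def by (rule in_seq_col_norm[OF v(1)])
      show "m = n" if "u m l \<noteq> 0" "u n l \<noteq> 0" for l m n using uniq[of l m n] u0 that by blast
    qed
    finally show ?thesis by (simp add: mnorm_def u_def[abs_def])
  qed
  have "level_estimate f UNIV snd 1 1"
    unfolding level_estimate_def using est by simp
  moreover have "(\<lambda>L. mnorm e f (restr (levset UNIV snd {L..}) y)) \<longlonglongrightarrow> 0" if y: "y \<in> mixed_space e f" for y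
  proof -
    have "seqnorm e (\<lambda>i. restr (levset UNIV snd {L..}) y i j) = (if L \<le> j then seqnorm e (\<lambda>i. y i j) else 0)" for L j
      using seqnorm_zero[OF e] by (simp add: restr_def levset_def)
    then show ?thesis
      using seqnorm_tail_tendsto[OF f in_seq_col_norm[OF y]] by (simp add: mnorm_def)
  qed
  ultimately show ?thesis
    unfolding level_system_def using f zero_less_one by blast
qed

text \<open>On the first n columns the norm is equivalent to the \<open>e\<close>-norm
  \<open>G\<close> of the row sums \<open>h\<close>, for which vectors on disjoint sets of rows
  satisfy an identity. Passing between \<open>mnorm\<close> and \<open>G\<close> costs a factor n
  each way, hence the constants n^2 and 1/n^2.\<close>

lemma level_system_rows:
  assumes n: "0 < n"
  shows "level_system e {(i, j). j < n} fst"
proof -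
  let ?R = "{(i, j). j < n} :: (nat \<times> nat) set"
  define h where "h y i = (\<Sum>j<n. \<bar>y i j\<bar>)" for y :: "nat \<Rightarrow> nat \<Rightarrow> real" and i
  define G where "G y = seqnorm e (h y)" for y
  have h: "in_seq e (h y) \<and> G y \<le> real n * mnorm e f y" if y: "y \<in> mixed_space e f" for y
  proof -
    have c: "in_seq e (\<lambda>i. \<bar>y i j\<bar>)" for j using in_seq_col[OF y] by (simp add: in_seq_abs)
    have "in_seq e (h y) \<and> G y \<le> (\<Sum>j<n. seqnorm e (\<lambda>i. \<bar>y i j\<bar>))"
      unfolding G_def h_def using in_seq_sum_seqnorm_sum[OF e, of "\<lambda>j i. \<bar>y i j\<bar>" n, OF c] .
    moreover have "(\<Sum>j<n. seqnorm e (\<lambda>i. \<bar>y i j\<bar>)) \<le> (\<Sum>j<n. mnorm e f y)"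
    proof (rule sum_mono)
      fix j
      show "seqnorm e (\<lambda>i. \<bar>y i j\<bar>) \<le> mnorm e f y"
        using abs_le_seqnorm[OF f in_seq_col_norm[OF y], of j] by (simp add: seqnorm_abs mnorm_def)
    qed
    ultimately show ?thesis by simp
  qed
  have N_le: "mnorm e f y \<le> real n * G y"
    if y: "y \<in> mixed_space e f" and R: "\<And>i j. n \<le> j \<Longrightarrow> y i j = 0" for y
  proof -
    have hy: "in_seq e (h y)" using h[OF y] by blast
    have G0: "0 \<le> G y" unfolding G_def by (rule seqnorm_nonneg[OF hy])
    \<comment> \<open>\<open>?d k\<close> places the value \<open>G y\<close> in column
      \<open>k\<close> alone; the sequence of column norms is dominated by the sum of n such
      sequences.\<close>
    let ?d = "\<lambda>k j. if j = k then G y else 0"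
    have d: "in_seq f (?d k)" for k by (rule in_seq_finite_support[OF f]) auto
    note s = in_seq_sum_seqnorm_sum[OF f, of ?d n, OF d]
    have "\<bar>seqnorm e (\<lambda>i. y i j)\<bar> \<le> \<bar>\<Sum>k<n. ?d k j\<bar>" for j
    proof (cases "j < n")
      case True
      have "\<bar>y i j\<bar> \<le> \<bar>h y i\<bar>" for i
        unfolding h_def using True member_le_sum[of j "{..<n}" "\<lambda>j. \<bar>y i j\<bar>"]
        by (auto intro: order_trans[OF _ abs_ge_self])
      then have "seqnorm e (\<lambda>i. y i j) \<le> G y"
        unfolding G_def by (rule seqnorm_mono[OF e hy])
      then show ?thesis using True G0 seqnorm_nonneg[OF in_seq_col[OF y], of j] by (simp add: sum.delta)
    next
      case False
      then show ?thesis using R[of j] seqnorm_zero[OF e] by simp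
    qed
    then have "mnorm e f y \<le> seqnorm f (\<lambda>j. \<Sum>k<n. ?d k j)"
      unfolding mnorm_def by (rule seqnorm_mono[OF f s[THEN conjunct1]])
    also have "\<dots> \<le> (\<Sum>k<n. seqnorm f (?d k))" using s by blast
    also have "\<dots> = real n * G y" using G0 by (simp add: seqnorm_single[OF f])
    finally show ?thesis .
  qed
  have n0: "0 < real n * real n" using n by simp
  have est: "1 / (real n * real n) * unit_norm e M (\<lambda>m. a m * mnorm e f (v m)) \<le> mnorm e f (lcomb {..<M} a v)
      \<and> mnorm e f (lcomb {..<M} a v) \<le> (real n * real n) * unit_norm e M (\<lambda>m. a m * mnorm e f (v m))"
    if J: "disjoint_family J"
      and v: "\<And>m. v m \<in> mixed_space e f" "\<And>m. restr (levset ?R fst (J m)) (v m) = v m" for J M a v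
  proof -
    have v0: "v m i j = 0" if "i \<notin> J m \<or> n \<le> j" for m i j
    proof -
      have "(i, j) \<notin> levset ?R fst (J m)" using that by (auto simp: levset_def)
      then show ?thesis using v(2)[of m] by (metis restr_def)
    qed
    have h0: "h (v m) i = 0" if "i \<notin> J m" for m i
      using v0 that by (simp add: h_def)
    have uniq: "m = k" if "i \<in> J m" "i \<in> J k" for m k i
      using J that by (auto simp: disjoint_family_on_def)
    let ?y = "lcomb {..<M} a v"
    have yX: "?y \<in> mixed_space e f" using v by (intro lcomb_mem) auto
    have y0: "?y i j = 0" if "n \<le> j" for i j using v0 that by (simp add: lcomb_def)
    have "h ?y i = \<bar>\<Sum>m<M. a m * h (v m) i\<bar>" for i
    proof (cases "\<exists>m<M. i \<in> J m")
      case True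
      then obtain m where m: "m < M" "i \<in> J m" by blast
      then have other: "i \<notin> J k" if "k \<noteq> m" for k using uniq that by blast
      have "?y i j = a m * v m i j" for j
        unfolding lcomb_def by (rule sum_eq_single_term[OF m(1)]) (simp add: v0 other)
      moreover have "(\<Sum>m<M. a m * h (v m) i) = a m * h (v m) i"
        by (rule sum_eq_single_term[OF m(1)]) (simp add: h0 other)
      moreover have "0 \<le> h (v m) i" by (simp add: h_def sum_nonneg)
      ultimately show ?thesis by (simp add: h_def[of ?y] abs_mult) (simp add: h_def sum_distrib_left)
    next
      case False
      then have "?y i j = 0" "(\<Sum>m<M. a m * h (v m) i) = 0" for j
        by (auto simp: lcomb_def v0 h0 intro!: sum.neutral)
      then show ?thesis by (simp add: h_def)
    qed
    then have "h ?y = (\<lambda>i. \<bar>\<Sum>m<M. a m * h (v m) i\<bar>)" by (simp add: fun_eq_iff)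
    then have "G ?y = seqnorm e (\<lambda>i. \<Sum>m<M. a m * h (v m) i)"
      by (simp add: G_def seqnorm_abs)
    also have "\<dots> = unit_norm e M (\<lambda>m. a m * seqnorm e (h (v m)))"
    proof (rule seqnorm_disjoint_sum[OF e])
      show "in_seq e (h (v m))" for m using h[OF v(1)] by blast
      show "m = k" if "h (v m) l \<noteq> 0" "h (v k) l \<noteq> 0" for l m k using uniq[of l m k] h0 that by blast
    qed
    finally have Gy: "G ?y = unit_norm e M (\<lambda>m. a m * G (v m))" by (simp add: G_def)
    have Gv: "0 \<le> G (v m)" for m unfolding G_def using seqnorm_nonneg h[OF v(1)] by blast
    have Nv: "0 \<le> mnorm e f (v m)" for m by (rule N_nonneg[OF v(1)])
    have "unit_norm e M (\<lambda>m. a m * mnorm e f (v m)) \<le> unit_norm e M (\<lambda>m. real n * (a m * G (v m)))"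
    proof (rule unit_norm_mono[OF e])
      fix m
      have "\<bar>a m\<bar> * mnorm e f (v m) \<le> \<bar>a m\<bar> * (real n * G (v m))"
        using N_le[OF v(1)] v0 by (intro mult_left_mono) auto
      then show "\<bar>a m * mnorm e f (v m)\<bar> \<le> \<bar>real n * (a m * G (v m))\<bar>"
        using Gv Nv by (simp add: abs_mult mult_ac)
    qed
    then have 1: "unit_norm e M (\<lambda>m. a m * mnorm e f (v m)) \<le> real n * G ?y"
      by (simp add: unit_norm_scale[OF e] Gy)
    also have "\<dots> \<le> real n * (real n * mnorm e f ?y)"
      using h[OF yX] by (intro mult_left_mono) auto
    finally have lower: "1 / (real n * real n) * unit_norm e M (\<lambda>m. a m * mnorm e f (v m)) \<le> mnorm e f ?y"
      using n0 by (simp add: divide_le_eq mult_ac)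
    have "unit_norm e M (\<lambda>m. a m * G (v m)) \<le> unit_norm e M (\<lambda>m. real n * (a m * mnorm e f (v m)))"
    proof (rule unit_norm_mono[OF e])
      fix m
      have "\<bar>a m\<bar> * G (v m) \<le> \<bar>a m\<bar> * (real n * mnorm e f (v m))"
        using h[OF v(1)] by (intro mult_left_mono) auto
      then show "\<bar>a m * G (v m)\<bar> \<le> \<bar>real n * (a m * mnorm e f (v m))\<bar>"
        using Gv Nv by (simp add: abs_mult mult_ac)
    qed
    then have "G ?y \<le> real n * unit_norm e M (\<lambda>m. a m * mnorm e f (v m))"
      by (simp add: unit_norm_scale[OF e] Gy)
    then have "real n * G ?y \<le> real n * (real n * unit_norm e M (\<lambda>m. a m * mnorm e f (v m)))"
      by (intro mult_left_mono) auto
    then show ?thesis using lower N_le[OF yX y0] by simp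
  qed
  have "level_estimate e ?R fst (1 / (real n * real n)) (real n * real n)"
    unfolding level_estimate_def using est by blast
  moreover have "(\<lambda>L. mnorm e f (restr (levset ?R fst {L..}) y)) \<longlonglongrightarrow> 0" if y: "y \<in> mixed_space e f" for y
  proof (rule Lim_null_comparison)
    let ?r = "\<lambda>L. restr (levset ?R fst {L..}) y"
    have hr: "h (?r L) = (\<lambda>i. if L \<le> i then h y i else 0)" for L
      by (auto simp: fun_eq_iff h_def restr_def levset_def)
    have "in_seq e (h y)" using h[OF y] by blast
    then have "(\<lambda>L. G (?r L)) \<longlonglongrightarrow> 0"
      using seqnorm_tail_tendsto[OF e] unfolding G_def hr by blast
    then show "(\<lambda>L. real n * G (?r L)) \<longlonglongrightarrow> 0"
      using tendsto_mult_right_zero by blast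
    have "mnorm e f (?r L) \<le> real n * G (?r L)" for L
      by (rule N_le[OF restr_mem[OF y]]) (auto simp: restr_def levset_def)
    then show "\<forall>\<^sub>F L in sequentially. norm (mnorm e f (?r L)) \<le> real n * G (?r L)"
      using N_nonneg[OF restr_mem[OF y]] by simp
  qed
  moreover have "0 < 1 / (real n * real n)" using n0 by simp
  ultimately show ?thesis
    unfolding level_system_def using e n0 by blast
qed

section \<open>The inner and the outer subsequence\<close>

theorem subsequences_equivalent:
  assumes "e \<noteq> f"
    and basis: "schauder_basis (mixed_space e f) (mnorm e f) x"
    and norm: "normalized (mnorm e f) x" and unc: "unconditional (mnorm e f) x"
  shows "subseq_equiv_unit_basis (mnorm e f) x e" and "subseq_equiv_unit_basis (mnorm e f) x f"
proof -
  interpret unconditional_matrix_basis "mixed_space e f" "mnorm e f" x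
    using basis norm unc by unfold_locales (auto simp: normalized_def)
  let ?R = "\<lambda>n. {(i, j). j < n} :: (nat \<times> nat) set"
  let ?E = "\<lambda>s i j. if (i, j) = s then 1 else 0 :: real"
  \<comment> \<open>Whatever the first n columns continue to detect must therefore lie in high
    rows.\<close>
  have null_rows: "(\<lambda>k. cf (restr (levset (?R n) fst {..<L}) (x k)) k) \<longlonglongrightarrow> 0" for n L
  proof (rule cf_restr_finite_tendsto_0[OF _ unit_matrix_mem])
    have "levset (?R n) fst {..<L} \<subseteq> {..<L} \<times> {..<n}" by (auto simp: levset_def)
    then show "finite (levset (?R n) fst {..<L})" by (rule finite_subset) simp
  qed
  have cols: "levset UNIV snd {..<n} = ?R n" for n by (auto simp: levset_def)
  have cf_x: "cf (restr UNIV (x k)) k = 1" for k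
  proof -
    have "restr UNIV (x k) = lcomb {k} (\<lambda>k. 1) x" by (simp add: restr_def lcomb_def)
    then show ?thesis using cf_lcomb[of "{k}" "\<lambda>k. 1"] by simp
  qed
  \<comment> \<open>Otherwise low columns detect nothing in the limit while \<open>UNIV\<close>
    detects each \<open>x k\<close> completely (\<open>\<delta> = 1\<close>). The second system is
    the rows of column 0, carrying the unit matrices \<open>?E (m, 0)\<close>.\<close>
  have "\<exists>n. \<not> (\<lambda>k. cf (restr (?R n) (x k)) k) \<longlonglongrightarrow> 0"
  proof (rule ccontr)
    assume "\<not> ?thesis"
    then have null: "(\<lambda>k. cf (restr (levset UNIV snd {..<n}) (x k)) k) \<longlonglongrightarrow> 0" for n
      by (simp add: cols)
    have "f = e"
    proof (rule level_exponents_eq[OF level_system_columns level_system_rows[of 1] null,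
          where \<delta> = 1 and K = 0 and E = "\<lambda>m. ?E (m, 0)"])
      show "restr (levset (?R 1) fst {m}) (?E (m, 0)) = ?E (m, 0)" for m
        by (auto simp: fun_eq_iff restr_def levset_def)
    qed (simp_all only: unit_matrix_mem mnorm_unit_matrix cf_x abs_one order_refl zero_less_one)
    then show False using assms(1) by simp
  qed
  then obtain n where n: "\<not> (\<lambda>k. cf (restr (?R n) (x k)) k) \<longlonglongrightarrow> 0" by blast
  have "0 < n"
  proof (rule ccontr)
    assume "\<not> 0 < n"
    then have "restr (?R n) (x k) = (\<lambda>i j. 0)" for k by (simp add: restr_def)
    then show False using n by (simp add: cf_zero)
  qed
  obtain \<delta> where \<delta>: "0 < \<delta>" "\<And>k0. \<exists>k\<ge>k0. \<delta> \<le> \<bar>cf (restr (?R n) (x k)) k\<bar>"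
  proof -
    from n obtain r where "0 < r" "\<nexists>k0. \<forall>k\<ge>k0. norm (cf (restr (?R n) (x k)) k - 0) < r"
      unfolding LIMSEQ_iff by blast
    then show ?thesis using that[of r] by (metis diff_zero not_le real_norm_def)
  qed
  show "subseq_equiv_unit_basis (mnorm e f) x e"
  proof (rule subseq_equiv_unit_basis_if_levels[OF level_system_rows[OF \<open>0 < n\<close>], where \<delta> = "\<delta> / 2"])
    fix L k0
    obtain k1 where k1: "\<And>k. k1 \<le> k \<Longrightarrow> \<bar>cf (restr (levset (?R n) fst {..<L}) (x k)) k\<bar> < \<delta> / 2"
      using LIMSEQ_D[OF null_rows[of n L], of "\<delta> / 2"] \<delta>(1) by auto
    obtain k where k: "max k0 k1 \<le> k" "\<delta> \<le> \<bar>cf (restr (?R n) (x k)) k\<bar>" using \<delta>(2) by blast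
    have "\<delta> / 2 \<le> \<bar>cf (restr (levset (?R n) fst {L..}) (x k)) k\<bar>"
      using k k1[of k] cf_levset_lessThan[OF x_mem, of "?R n" k k fst L] by auto
    then show "\<exists>k\<ge>k0. \<delta> / 2 \<le> \<bar>cf (restr (levset (?R n) fst {L..}) (x k)) k\<bar>" using k by auto
  qed (use \<delta> in auto)
  \<comment> \<open>An \<open>x k\<close> with less than 1/2 in the first n columns has more than
    1/2 in the others, as the total is 1. If only finitely many were of this kind, the rows of these
    columns would detect all later \<open>x k\<close>; comparison with the unit matrices
    \<open>?E (0, m)\<close>, one per column, would force \<open>e = f\<close>.\<close>
  have "\<exists>k\<ge>k0. \<bar>cf (restr (?R n) (x k)) k\<bar> < 1/2" for n k0
  proof (rule ccontr)
    assume "\<not> ?thesis"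
    then have big: "1/2 \<le> \<bar>cf (restr (?R n) (x k)) k\<bar>" if "k0 \<le> k" for k
      using that by (auto simp: not_less)
    have "0 < n"
    proof (rule ccontr)
      assume "\<not> 0 < n"
      then have "restr (?R n) (x k0) = (\<lambda>i j. 0)" by (simp add: restr_def)
      then show False using big[of k0] by (simp add: cf_zero)
    qed
    have "e = f"
    proof (rule level_exponents_eq[OF level_system_rows[OF \<open>0 < n\<close>] level_system_columns null_rows,
          where \<delta> = "1/2" and K = k0 and E = "\<lambda>m. ?E (0, m)"])
      show "restr (levset UNIV snd {m}) (?E (0, m)) = ?E (0, m)" for m
        by (auto simp: fun_eq_iff restr_def levset_def)
      show "1/2 \<le> \<bar>cf (restr (?R n) (x k)) k\<bar>" if "k0 \<le> k" for k by (rule big[OF that])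
    qed (simp_all add: unit_matrix_mem mnorm_unit_matrix del: prod.inject)
    then show False using assms(1) by simp
  qed note small = this
  show "subseq_equiv_unit_basis (mnorm e f) x f"
  proof (rule subseq_equiv_unit_basis_if_levels[OF level_system_columns, where \<delta> = "1/2"])
    fix L k0
    obtain k where k: "k0 \<le> k" "\<bar>cf (restr (?R L) (x k)) k\<bar> < 1/2" using small by blast
    then have "1/2 \<le> \<bar>cf (restr (levset UNIV snd {L..}) (x k)) k\<bar>"
      using cf_levset_lessThan[OF x_mem, of UNIV k k snd L] by (simp add: cols cf_x)
    then show "\<exists>k\<ge>k0. 1/2 \<le> \<bar>cf (restr (levset UNIV snd {L..}) (x k)) k\<bar>" using k by auto
  qed auto
qed

end

section \<open>Greedy bases\<close>

context solid_matrix_norm begin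

lemma greedyE:
  assumes "greedy X N x"
  obtains C where "1 \<le> C"
    "\<And>y a A B b. y \<in> X \<Longrightarrow> expands N x y a \<Longrightarrow> finite A \<Longrightarrow> finite B \<Longrightarrow> card B = card A \<Longrightarrow>
      (\<And>i j. i \<in> A \<Longrightarrow> j \<notin> A \<Longrightarrow> \<bar>a j\<bar> \<le> \<bar>a i\<bar>) \<Longrightarrow> (\<And>k. x k \<in> X) \<Longrightarrow>
      N (y - lcomb A a x) \<le> C * N (y - lcomb B b x)"
proof -
  obtain C where C: "\<And>y a A B b. y \<in> X \<Longrightarrow> expands N x y a \<Longrightarrow>
      finite A \<Longrightarrow> finite B \<Longrightarrow> card B = card A \<Longrightarrow>
      (\<forall>i\<in>A. \<forall>j. j \<notin> A \<longrightarrow> \<bar>a j\<bar> \<le> \<bar>a i\<bar>) \<Longrightarrow>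
      N (y - lcomb A a x) \<le> C * N (y - lcomb B b x)"
    using assms unfolding greedy_def by blast
  show ?thesis
  proof (rule that[of "max 1 C"])
    fix y and a b :: "nat \<Rightarrow> real" and A B :: "nat set"
    assume *: "y \<in> X" "expands N x y a" "finite A" "finite B" "card B = card A"
      "\<And>i j. i \<in> A \<Longrightarrow> j \<notin> A \<Longrightarrow> \<bar>a j\<bar> \<le> \<bar>a i\<bar>" "\<And>k. x k \<in> X"
    have "N (y - lcomb A a x) \<le> C * N (y - lcomb B b x)"
      using * by (intro C) auto
    also have "\<dots> \<le> max 1 C * N (y - lcomb B b x)"
      using * by (intro mult_right_mono N_nonneg minus_mem lcomb_mem) auto
    finally show "N (y - lcomb A a x) \<le> max 1 C * N (y - lcomb B b x)" .
  qed simp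
qed

lemma lcomb_Un_disjoint:
  "finite A \<Longrightarrow> finite B \<Longrightarrow> A \<inter> B = {} \<Longrightarrow> lcomb (A \<union> B) c x i j = lcomb A c x i j + lcomb B c x i j"
  by (simp add: lcomb_def sum.union_disjoint)

text \<open>Raising the coefficients on \<open>A\<close> to a common large value makes \<open>A\<close> a greedy set; the
  original vector is then a competing approximation error with the same index set.\<close>

lemma greedy_suppression_bound:
  assumes x: "\<And>k. x k \<in> X" and greedy: "greedy X N x"
  obtains C where "1 \<le> C"
    "\<And>K A a. finite K \<Longrightarrow> A \<subseteq> K \<Longrightarrow> N (lcomb (K - A) a x) \<le> C * N (lcomb K a x)"
proof -
  obtain C where C: "1 \<le> C"
    "\<And>y a A B b. y \<in> X \<Longrightarrow> expands N x y a \<Longrightarrow> finite A \<Longrightarrow> finite B \<Longrightarrow> card B = card A \<Longrightarrow>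
      (\<And>i j. i \<in> A \<Longrightarrow> j \<notin> A \<Longrightarrow> \<bar>a j\<bar> \<le> \<bar>a i\<bar>) \<Longrightarrow> (\<And>k. x k \<in> X) \<Longrightarrow>
      N (y - lcomb A a x) \<le> C * N (y - lcomb B b x)"
    using greedyE[OF greedy] by blast
  show ?thesis
  proof (rule that[OF C(1)])
    fix K A :: "nat set" and a :: "nat \<Rightarrow> real"
    assume K: "finite K" and A: "A \<subseteq> K"
    \<comment> \<open>The sum of the moduli bounds each of them and covers an empty \<open>K\<close>
      without a separate case.\<close>
    define t where "t = (\<Sum>k\<in>K. \<bar>a k\<bar>)"
    define a' where "a' k = (if k \<in> A then t else a k)" for k
    define \<alpha> where "\<alpha> k = (if k \<in> K then a' k else 0)" for k
    have fA: "finite A" using K A finite_subset by blast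
    have K_eq: "K = A \<union> (K - A)" using A by blast
    have split: "lcomb K c x i j = lcomb A c x i j + lcomb (K - A) c x i j" for c i j
      using lcomb_Un_disjoint[OF fA, of "K - A"] K A K_eq by (metis Diff_disjoint finite_Diff)
    have t: "\<bar>a k\<bar> \<le> t" if "k \<in> K" for k
      unfolding t_def using K that by (intro member_le_sum) auto
    have t0: "0 \<le> t" unfolding t_def by (intro sum_nonneg) auto
    have "N (lcomb K a' x - lcomb A \<alpha> x) \<le> C * N (lcomb K a' x - lcomb A (\<lambda>k. t - a k) x)"
    proof (rule C(2))
      show "expands N x (lcomb K a' x) \<alpha>"
        unfolding \<alpha>_def by (rule expands_lcomb[OF K])
      show "\<bar>\<alpha> j\<bar> \<le> \<bar>\<alpha> i\<bar>" if "i \<in> A" "j \<notin> A" for i j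
        using that A t[of j] t0 by (auto simp: \<alpha>_def a'_def)
    qed (use x fA lcomb_mem in auto)
    moreover have "lcomb K a' x - lcomb A \<alpha> x = lcomb (K - A) a x"
    proof (intro ext)
      fix i j
      have "lcomb A \<alpha> x i j = lcomb A a' x i j" "lcomb (K - A) a' x i j = lcomb (K - A) a x i j"
        using A by (auto simp: lcomb_def \<alpha>_def a'_def intro!: sum.cong)
      then show "(lcomb K a' x - lcomb A \<alpha> x) i j = lcomb (K - A) a x i j"
        by (simp add: split[of a'])
    qed
    moreover have "lcomb K a' x - lcomb A (\<lambda>k. t - a k) x = lcomb K a x"
    proof (intro ext)
      fix i j
      have "lcomb A a' x i j - lcomb A (\<lambda>k. t - a k) x i j = lcomb A a x i j"
        unfolding lcomb_def a'_def sum_subtractf[symmetric]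
        by (intro sum.cong) (auto simp: algebra_simps)
      moreover have "lcomb (K - A) a' x i j = lcomb (K - A) a x i j"
        by (auto simp: lcomb_def a'_def intro!: sum.cong)
      ultimately show "(lcomb K a' x - lcomb A (\<lambda>k. t - a k) x) i j = lcomb K a x i j"
        by (simp add: split)
    qed
    ultimately show "N (lcomb (K - A) a x) \<le> C * N (lcomb K a x)" by simp
  qed
qed

section \<open>Greedy bases are unconditional and democratic\<close>

text \<open>A sign change is the difference of two suppressed sums, over the indices with sign 1 and
  with sign -1, hence the constant \<open>2 * C\<close>.\<close>

lemma greedy_imp_unconditional:
  assumes x: "\<And>k. x k \<in> X" and greedy: "greedy X N x"
  shows "unconditional N x"
proof -
  obtain C where C: "1 \<le> C"
    "\<And>K A a. finite K \<Longrightarrow> A \<subseteq> K \<Longrightarrow> N (lcomb (K - A) a x) \<le> C * N (lcomb K a x)"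
    using greedy_suppression_bound[OF x greedy] by blast
  have "N (lcomb {..<n} (\<lambda>i. \<epsilon> i * a i) x) \<le> 2 * C * N (lcomb {..<n} a x)"
    if "\<forall>i. \<epsilon> i = 1 \<or> \<epsilon> i = -1" for n a \<epsilon>
  proof -
    let ?P = "{k \<in> {..<n}. \<epsilon> k = 1}" and ?M = "{k \<in> {..<n}. \<epsilon> k \<noteq> 1}"
    have split: "{..<n} = ?P \<union> ?M" by blast
    have "lcomb {..<n} (\<lambda>i. \<epsilon> i * a i) x i j = lcomb ?P a x i j - lcomb ?M a x i j" for i j
    proof -
      have "lcomb {..<n} (\<lambda>i. \<epsilon> i * a i) x i j
          = lcomb ?P (\<lambda>i. \<epsilon> i * a i) x i j + lcomb ?M (\<lambda>i. \<epsilon> i * a i) x i j"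
        by (subst split, rule lcomb_Un_disjoint) auto
      moreover have "lcomb ?M (\<lambda>i. \<epsilon> i * a i) x i j = - lcomb ?M a x i j"
        unfolding lcomb_def sum_negf[symmetric] using that by (intro sum.cong) auto
      moreover have "lcomb ?P (\<lambda>i. \<epsilon> i * a i) x i j = lcomb ?P a x i j"
        by (simp add: lcomb_def)
      ultimately show ?thesis by simp
    qed
    then have "lcomb {..<n} (\<lambda>i. \<epsilon> i * a i) x = (\<lambda>i j. lcomb ?P a x i j - lcomb ?M a x i j)"
      by (simp add: fun_eq_iff)
    then have "N (lcomb {..<n} (\<lambda>i. \<epsilon> i * a i) x) \<le> N (lcomb ?P a x) + N (lcomb ?M a x)"
      using N_diff[OF lcomb_mem lcomb_mem] x by simp
    moreover have "?P = {..<n} - ?M" "?M = {..<n} - ?P" by auto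
    then have "N (lcomb ?P a x) \<le> C * N (lcomb {..<n} a x)" "N (lcomb ?M a x) \<le> C * N (lcomb {..<n} a x)"
      using C(2)[of "{..<n}" ?M a] C(2)[of "{..<n}" ?P a] by auto
    ultimately show ?thesis by simp
  qed
  then show ?thesis unfolding unconditional_def by blast
qed

text \<open>For disjoint sets the coefficients of the sum over the union are tied, so
  \<open>B\<close> is a greedy set and \<open>A\<close> an admissible competitor. Overlapping sets
  are compared through a third set beyond both, at the price of \<open>C * C\<close>.\<close>

lemma greedy_imp_democratic:
  assumes x: "\<And>k. x k \<in> X" and greedy: "greedy X N x"
  shows "\<exists>C. \<forall>A B. finite A \<longrightarrow> finite B \<longrightarrow> card A = card B \<longrightarrow>
      N (lcomb A (\<lambda>k. 1) x) \<le> C * N (lcomb B (\<lambda>k. 1) x)"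
proof -
  obtain C where C: "1 \<le> C"
    "\<And>y a A B b. y \<in> X \<Longrightarrow> expands N x y a \<Longrightarrow> finite A \<Longrightarrow> finite B \<Longrightarrow> card B = card A \<Longrightarrow>
      (\<And>i j. i \<in> A \<Longrightarrow> j \<notin> A \<Longrightarrow> \<bar>a j\<bar> \<le> \<bar>a i\<bar>) \<Longrightarrow> (\<And>k. x k \<in> X) \<Longrightarrow>
      N (y - lcomb A a x) \<le> C * N (y - lcomb B b x)"
    using greedyE[OF greedy] by blast
  have disj: "N (lcomb A (\<lambda>k. 1) x) \<le> C * N (lcomb B (\<lambda>k. 1) x)"
    if fin: "finite A" "finite B" and card: "card A = card B" and AB: "A \<inter> B = {}" for A B
  proof -
    let ?y = "lcomb (A \<union> B) (\<lambda>k. 1) x"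
    let ?a = "\<lambda>k. if k \<in> A \<union> B then 1 else 0 :: real"
    have "N (?y - lcomb B ?a x) \<le> C * N (?y - lcomb A (\<lambda>k. 1) x)"
      by (rule C(2)) (use fin card x lcomb_mem expands_lcomb[of "A \<union> B" x "\<lambda>k. 1"] in auto)
    moreover have "lcomb B ?a x = lcomb B (\<lambda>k. 1) x" by (simp add: lcomb_def cong: sum.cong)
    then have "?y - lcomb B ?a x = lcomb A (\<lambda>k. 1) x" "?y - lcomb A (\<lambda>k. 1) x = lcomb B (\<lambda>k. 1) x"
      by (auto simp: fun_eq_iff lcomb_Un_disjoint[OF fin AB])
    ultimately show ?thesis by simp
  qed
  show ?thesis
  proof (intro exI[of _ "C * C"] allI impI)
    fix A B :: "nat set" assume fin: "finite A" "finite B" and card: "card A = card B"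
    obtain z where z: "\<forall>k\<in>A \<union> B. k < z" using fin finite_nat_set_iff_bounded[of "A \<union> B"] by auto
    let ?E = "{z..<z + card A}"
    have "A \<inter> ?E = {}" "?E \<inter> B = {}" using z by (auto; metis UnCI not_le)+
    then have "N (lcomb A (\<lambda>k. 1) x) \<le> C * N (lcomb ?E (\<lambda>k. 1) x)"
      and "N (lcomb ?E (\<lambda>k. 1) x) \<le> C * N (lcomb B (\<lambda>k. 1) x)"
      using disj[of A ?E] disj[of ?E B] fin card by simp_all
    note this(1)
    also have "C * N (lcomb ?E (\<lambda>k. 1) x) \<le> C * (C * N (lcomb B (\<lambda>k. 1) x))"
      using \<open>N (lcomb ?E (\<lambda>k. 1) x) \<le> C * N (lcomb B (\<lambda>k. 1) x)\<close> C(1) by (intro mult_left_mono) auto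
    finally show "N (lcomb A (\<lambda>k. 1) x) \<le> C * C * N (lcomb B (\<lambda>k. 1) x)" by simp
  qed
qed

section \<open>Normalization and the contradiction\<close>

text \<open>A vanishing \<open>x k\<close> would leave its coefficient in the expansion of 0
  arbitrary, against uniqueness.\<close>

lemma schauder_basis_norm_pos:
  assumes "schauder_basis X N x" shows "0 < N (x k)"
proof (rule ccontr)
  assume "\<not> 0 < N (x k)"
  have x: "x k \<in> X" for k using assms by (simp add: schauder_basis_def)
  then have 0: "N (x k) = 0" using \<open>\<not> 0 < N (x k)\<close> N_nonneg[OF x, of k] by simp
  have entries: "x k i j = 0" for i j using abs_entry_le[OF x, of k i j] 0 by simp
  have "lcomb {..<n} (\<lambda>i. if i = k then 1 else 0) x = (\<lambda>i j. 0)" for n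
    by (auto simp: fun_eq_iff lcomb_def entries intro!: sum.neutral)
  then have "expands N x (\<lambda>i j. 0) (\<lambda>i. if i = k then 1 else 0)"
    by (simp add: expands_def fun_diff_def N_zero)
  moreover have "expands N x (\<lambda>i j. 0) (\<lambda>i. 0)"
    by (simp add: expands_def fun_diff_def lcomb_def N_zero)
  ultimately have "(\<lambda>i. if i = k then 1 else 0 :: real) = (\<lambda>i. 0)"
    using assms zero_mem unfolding schauder_basis_def by blast
  then show False by (metis zero_neq_one)
qed

lemma lcomb_normalized: "lcomb K c (\<lambda>k i j. x k i j / \<nu> k) = lcomb K (\<lambda>k. c k / \<nu> k) x"
  by (simp add: lcomb_def)

lemma schauder_basis_normalize:
  assumes basis: "schauder_basis X N x" and \<nu>: "\<And>k. \<nu> k \<noteq> 0"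
  shows "schauder_basis X N (\<lambda>k i j. x k i j / \<nu> k)"
proof -
  have x: "x k \<in> X" for k using basis by (simp add: schauder_basis_def)
  have "\<exists>!c. expands N (\<lambda>k i j. x k i j / \<nu> k) y c" if "y \<in> X" for y
  proof -
    have ex: "expands N (\<lambda>k i j. x k i j / \<nu> k) y c \<longleftrightarrow> expands N x y (\<lambda>k. c k / \<nu> k)" for c
      by (simp add: expands_def lcomb_normalized)
    have "\<exists>!c. expands N x y c" using basis that by (simp add: schauder_basis_def)
    then obtain d where d: "expands N x y d" "\<And>c. expands N x y c \<Longrightarrow> c = d"
      by (rule ex1E) blast
    show ?thesis
    proof (rule ex1I[of _ "\<lambda>k. d k * \<nu> k"])
      show "expands N (\<lambda>k i j. x k i j / \<nu> k) y (\<lambda>k. d k * \<nu> k)"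
        unfolding ex using d(1) \<nu> by simp
      fix c assume "expands N (\<lambda>k i j. x k i j / \<nu> k) y c"
      then have "(\<lambda>k. c k / \<nu> k) = d" unfolding ex by (rule d(2))
      then show "c = (\<lambda>k. d k * \<nu> k)" using \<nu> by auto
    qed
  qed
  moreover have "(\<lambda>i j. x k i j / \<nu> k) \<in> X" for k
    using scale_mem[OF x, of "1 / \<nu> k" k] by simp
  ultimately show ?thesis unfolding schauder_basis_def by blast
qed

text \<open>Democracy concerns \<open>x\<close>, the two subsequences its normalization. One-element
  sets show that the norms of the \<open>x k\<close> lie between positive constants, so the passage
  costs only constants; democracy then compares sums of n terms along the two subsequences.\<close>

lemma democratic_exponents_eq:
  assumes x: "\<And>k. x k \<in> X" and dem: "\<forall>A B. finite A \<longrightarrow> finite B \<longrightarrow> card A = card B \<longrightarrow>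
      N (lcomb A (\<lambda>k. 1) x) \<le> C * N (lcomb B (\<lambda>k. 1) x)"
    and pos: "\<And>k. 0 < N (x k)" and g: "banach_exponent g" "banach_exponent h"
    and sub: "subseq_equiv_unit_basis N (\<lambda>k i j. x k i j / N (x k)) g"
      "subseq_equiv_unit_basis N (\<lambda>k i j. x k i j / N (x k)) h"
  shows "g = h"
proof -
  note C = dem[rule_format]
  define \<alpha> where "\<alpha> = N (x 0) / C"
  define \<beta> where "\<beta> = C * N (x 0)"
  have le: "N (x k) \<le> C * N (x l)" for k l
    using C[of "{k}" "{l}"] by (simp add: lcomb_def)
  \<comment> \<open>\<open>C\<close> comes without a sign; the singleton {0} compared with itself
    forces it to be positive.\<close>
  have Cpos: "0 < C" using le[of 0 0] pos[of 0] by (metis less_le_trans zero_less_mult_pos2)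
  have bounds: "\<alpha> \<le> N (x k)" "N (x k) \<le> \<beta>" for k
    using le[of 0 k] le[of k 0] Cpos by (auto simp: \<alpha>_def \<beta>_def divide_le_eq mult.commute)
  have ab: "0 < \<alpha>" "0 < \<beta>" using pos[of 0] Cpos by (auto simp: \<alpha>_def \<beta>_def)
  let ?U = "\<lambda>g n. unit_norm g n (\<lambda>i. 1)"
  have est: "\<exists>\<phi> c d. strict_mono \<phi> \<and> 0 < c \<and> 0 < d \<and> (\<forall>n. c * ?U g n \<le> N (lcomb (\<phi> ` {..<n}) (\<lambda>k. 1) x)
      \<and> N (lcomb (\<phi> ` {..<n}) (\<lambda>k. 1) x) \<le> d * ?U g n)"
    if sub: "subseq_equiv_unit_basis N (\<lambda>k i j. x k i j / N (x k)) g" and g: "banach_exponent g" for g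
  proof -
    let ?x = "\<lambda>k i j. x k i j / N (x k)"
    obtain \<phi> c d where \<phi>: "strict_mono \<phi>" and cd: "0 < c" "c \<le> d"
      "\<And>n a. c * unit_norm g n a \<le> N (lcomb {..<n} a (?x \<circ> \<phi>))"
      "\<And>n a. N (lcomb {..<n} a (?x \<circ> \<phi>)) \<le> d * unit_norm g n a"
      using sub unfolding subseq_equiv_unit_basis_def equiv_unit_basis_def by blast
    \<comment> \<open>Over the normalized vectors, the plain sum of the \<open>x (\<phi> k)\<close>
      has coefficients \<open>N (x (\<phi> k))\<close>, which lie between \<open>\<alpha>\<close>
      and \<open>\<beta>\<close>.\<close>
    have eq: "lcomb (\<phi> ` {..<n}) (\<lambda>k. 1) x = lcomb {..<n} (\<lambda>k. N (x (\<phi> k))) (?x \<circ> \<phi>)" for n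
      using pos strict_mono_imp_inj_on[OF \<phi>]
      by (simp add: lcomb_def sum.reindex inj_on_subset fun_eq_iff less_imp_neq[symmetric] cong: sum.cong)
    have "unit_norm g n (\<lambda>k. \<alpha> * 1) \<le> unit_norm g n (\<lambda>k. N (x (\<phi> k)))"
      and "unit_norm g n (\<lambda>k. N (x (\<phi> k))) \<le> unit_norm g n (\<lambda>k. \<beta> * 1)" for n
      using bounds ab pos by (auto intro!: unit_norm_mono[OF g] simp: less_imp_le abs_of_pos)
    then have u: "\<alpha> * ?U g n \<le> unit_norm g n (\<lambda>k. N (x (\<phi> k)))"
      "unit_norm g n (\<lambda>k. N (x (\<phi> k))) \<le> \<beta> * ?U g n" for n
      using ab by (simp_all only: unit_norm_scale[OF g] abs_of_pos)
    have "c * \<alpha> * ?U g n \<le> N (lcomb (\<phi> ` {..<n}) (\<lambda>k. 1) x)" for n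
    proof -
      have "c * (\<alpha> * ?U g n) \<le> c * unit_norm g n (\<lambda>k. N (x (\<phi> k)))"
        using u cd(1) by (intro mult_left_mono) auto
      then show ?thesis using cd(3)[of n "\<lambda>k. N (x (\<phi> k))"] unfolding eq by simp
    qed
    moreover have "N (lcomb (\<phi> ` {..<n}) (\<lambda>k. 1) x) \<le> d * \<beta> * ?U g n" for n
    proof -
      have "d * unit_norm g n (\<lambda>k. N (x (\<phi> k))) \<le> d * (\<beta> * ?U g n)"
        using u cd(1,2) by (intro mult_left_mono) auto
      then show ?thesis using cd(4)[of n "\<lambda>k. N (x (\<phi> k))"] unfolding eq by simp
    qed
    moreover have "0 < c * \<alpha>" "0 < d * \<beta>" using cd ab by auto
    ultimately show ?thesis using \<phi> by blast
  qed
  obtain \<phi> c d where \<phi>: "strict_mono \<phi>" "0 < c" "0 < d"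
    "\<And>n. c * ?U g n \<le> N (lcomb (\<phi> ` {..<n}) (\<lambda>k. 1) x)"
    "\<And>n. N (lcomb (\<phi> ` {..<n}) (\<lambda>k. 1) x) \<le> d * ?U g n"
    using est[OF sub(1) g(1)] by blast
  obtain \<psi> c' d' where \<psi>: "strict_mono \<psi>" "0 < c'" "0 < d'"
    "\<And>n. c' * ?U h n \<le> N (lcomb (\<psi> ` {..<n}) (\<lambda>k. 1) x)"
    "\<And>n. N (lcomb (\<psi> ` {..<n}) (\<lambda>k. 1) x) \<le> d' * ?U h n"
    using est[OF sub(2) g(2)] by blast
  have card: "card (\<phi> ` {..<n}) = n" "card (\<psi> ` {..<n}) = n" for n
    using strict_mono_imp_inj_on[OF \<phi>(1)] strict_mono_imp_inj_on[OF \<psi>(1)]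
    by (simp_all add: card_image inj_on_subset)
  show ?thesis
  proof (rule exponent_eq_if_unit_norm_ones_equivalent[OF g])
    fix n :: nat
    have "c * ?U g n \<le> C * N (lcomb (\<psi> ` {..<n}) (\<lambda>k. 1) x)"
      using \<phi>(4)[of n] C[of "\<phi> ` {..<n}" "\<psi> ` {..<n}"] by (simp add: card)
    also have "\<dots> \<le> C * (d' * ?U h n)" using \<psi>(5) Cpos by (intro mult_left_mono) auto
    finally show "?U g n \<le> (C * d' / c) * ?U h n" using \<phi>(2) by (simp add: field_simps)
    have "c' * ?U h n \<le> C * N (lcomb (\<phi> ` {..<n}) (\<lambda>k. 1) x)"
      using \<psi>(4)[of n] C[of "\<psi> ` {..<n}" "\<phi> ` {..<n}"] by (simp add: card)
    also have "\<dots> \<le> C * (d * ?U g n)" using \<phi>(5) Cpos by (intro mult_left_mono) auto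
    finally show "?U h n \<le> (C * d / c') * ?U g n" using \<psi>(2) by (simp add: field_simps)
  qed
qed

end

theorem (in mixed_sequence_space) no_greedy_basis:
  assumes "e \<noteq> f"
  shows "\<not> has_greedy_basis (mixed_space e f) (mnorm e f)"
proof
  assume "has_greedy_basis (mixed_space e f) (mnorm e f)"
  then obtain x where basis: "schauder_basis (mixed_space e f) (mnorm e f) x"
    and greedy: "greedy (mixed_space e f) (mnorm e f) x"
    unfolding has_greedy_basis_def by blast
  have x: "x k \<in> mixed_space e f" for k using basis by (simp add: schauder_basis_def)
  have pos: "0 < mnorm e f (x k)" for k by (rule schauder_basis_norm_pos[OF basis])
  let ?x = "\<lambda>k i j. x k i j / mnorm e f (x k)"
  have basis': "schauder_basis (mixed_space e f) (mnorm e f) ?x"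
    using pos by (intro schauder_basis_normalize[OF basis]) (metis less_irrefl)
  have "mnorm e f (?x k) = 1" for k
    using N_scale[OF x, of "1 / mnorm e f (x k)" k] pos[of k] by simp
  then have norm': "normalized (mnorm e f) ?x" by (simp add: normalized_def)
  obtain D where D: "\<And>n a \<epsilon>. \<forall>i. \<epsilon> i = 1 \<or> \<epsilon> i = - 1 \<Longrightarrow>
      mnorm e f (lcomb {..<n} (\<lambda>i. \<epsilon> i * a i) x) \<le> D * mnorm e f (lcomb {..<n} a x)"
    using greedy_imp_unconditional[OF x greedy] unfolding unconditional_def by metis
  \<comment> \<open>Normalizing only divides the coefficients by the norms, which commutes with sign
    changes; the constant \<open>D\<close> is kept.\<close>
  then have unc': "unconditional (mnorm e f) ?x"
    unfolding unconditional_def lcomb_normalized times_divide_eq_right[symmetric]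
    by (intro exI[of _ D] allI impI D) auto
  obtain C where dem: "\<forall>A B. finite A \<longrightarrow> finite B \<longrightarrow> card A = card B \<longrightarrow>
      mnorm e f (lcomb A (\<lambda>k. 1) x) \<le> C * mnorm e f (lcomb B (\<lambda>k. 1) x)"
    using greedy_imp_democratic[OF x greedy] ..
  have "e = f"
    by (rule democratic_exponents_eq[OF x dem pos e f subsequences_equivalent[OF assms basis' norm' unc']])
  then show False using assms by simp
qed

theorem theorem1:
  shows
  "(\<forall>p q x. 1 \<le> p \<longrightarrow> 1 \<le> q \<longrightarrow> p \<noteq> q \<longrightarrow>
      schauder_basis (mixed_space (Fin p) (Fin q)) (mnorm (Fin p) (Fin q)) x \<longrightarrow>
      normalized (mnorm (Fin p) (Fin q)) x \<longrightarrow> unconditional (mnorm (Fin p) (Fin q)) x \<longrightarrow>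
      subseq_equiv_unit_basis (mnorm (Fin p) (Fin q)) x (Fin p) \<and>
      subseq_equiv_unit_basis (mnorm (Fin p) (Fin q)) x (Fin q))
 \<and> (\<forall>p x. 1 \<le> p \<longrightarrow>
      schauder_basis (mixed_space (Fin p) C0) (mnorm (Fin p) C0) x \<longrightarrow>
      normalized (mnorm (Fin p) C0) x \<longrightarrow> unconditional (mnorm (Fin p) C0) x \<longrightarrow>
      subseq_equiv_unit_basis (mnorm (Fin p) C0) x (Fin p) \<and>
      subseq_equiv_unit_basis (mnorm (Fin p) C0) x C0)
 \<and> (\<forall>q x. 1 \<le> q \<longrightarrow>
      schauder_basis (mixed_space C0 (Fin q)) (mnorm C0 (Fin q)) x \<longrightarrow>
      normalized (mnorm C0 (Fin q)) x \<longrightarrow> unconditional (mnorm C0 (Fin q)) x \<longrightarrow>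
      subseq_equiv_unit_basis (mnorm C0 (Fin q)) x C0 \<and>
      subseq_equiv_unit_basis (mnorm C0 (Fin q)) x (Fin q))
 \<and> (\<forall>p q. 1 \<le> p \<longrightarrow> 1 \<le> q \<longrightarrow> p \<noteq> q \<longrightarrow>
      \<not> has_greedy_basis (mixed_space (Fin p) (Fin q)) (mnorm (Fin p) (Fin q)))
 \<and> (\<forall>p. 1 \<le> p \<longrightarrow> \<not> has_greedy_basis (mixed_space (Fin p) C0) (mnorm (Fin p) C0))
 \<and> (\<forall>q. 1 \<le> q \<longrightarrow> \<not> has_greedy_basis (mixed_space C0 (Fin q)) (mnorm C0 (Fin q)))"
proof -
  have "mixed_sequence_space e f" if "banach_exponent e" "banach_exponent f" for e f
    using that by unfold_locales
  note subs = mixed_sequence_space.subsequences_equivalent[OF this]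
    and no_greedy = mixed_sequence_space.no_greedy_basis[OF this]
  show ?thesis
    by (intro conjI allI impI subs no_greedy) auto
qed

end
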